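(* Let $k$ be an algebraically closed field of characteristic zero and let $n \geq 2$ be an integer. Every irreducible solvable finite dimensional representation of the Yang-Mills algebra $\mathfrak{ym}(n)$ is of dimension $1$. Moreover, the set of isomorphism classes of irreducible solvable finite dimensional representations of $\mathfrak{ym}(n)$ is parametrized by the dual vector space $(\mathfrak{ym}(n)/\mathcal{C}^1(\mathfrak{ym}(n)))^*$.
   Context: For an integer $n \geq 2$, let $\mathfrak{f}(n)$ be the free Lie algebra over $k$ on generators $x_1,\dots,x_n$. The Lie Yang-Mills algebra is the quotient $\mathfrak{ym}(n) = \mathfrak{f}(n)/\langle \sum_{i=1}^n [x_i,[x_i,x_j]] : 1 \leq j \leq n\rangle$ by the Lie ideal generated by the indicated elements. The lower central series of a Lie algebra $\mathfrak{g}$ is $\mathcal{C}^0(\mathfrak{g})=\mathfrak{g}$, $\mathcal{C}^{m+1}(\mathfrak{g}) = [\mathfrak{g},\mathcal{C}^m(\mathfrak{g})]$; in particular $\mathcal{C}^1(\mathfrak{g})=[\mathfrak{g},\mathfrak{g}]$. A finite dimensional representation $\phi:\mathfrak{ym}(n)\to\mathfrak{gl}(V)$ is called solvable if its image $\phi(\mathfrak{ym}(n))$ is a solvable Lie algebra. In the parametrization, a linear form $\bar\phi \in (\mathfrak{ym}(n)/\mathcal{C}^1(\mathfrak{ym}(n)))^*$ corresponds to the one dimensional representation $k$ on which $x \in \mathfrak{ym}(n)$ acts as multiplication by $\bar\phi(x + \mathcal{C}^1(\mathfrak{ym}(n)))$. *)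

theory Defs
  imports
    "HOL-Computational_Algebra.Polynomial"
    "HOL-Library.Function_Algebras"
    "HOL-Library.Cardinality"
begin

section \<open>Lie algebras\<close>

text \<open>
  A Lie algebra is a subspace \<open>L\<close> of an ambient vector space, together with a bracket that is
  only required to behave well on \<open>L\<close>.  The carrier is needed because the commutator makes
  the linear endomorphisms, but not all functions, into a Lie algebra.
\<close>

locale lie_algebra = vector_space scale
  for scale :: "'k::field \<Rightarrow> 'g::ab_group_add \<Rightarrow> 'g" +
  fixes bracket :: "'g \<Rightarrow> 'g \<Rightarrow> 'g" and L :: "'g set"
  assumes subspace_carrier: "subspace L"
    and bracket_closed: "\<lbrakk>x \<in> L; y \<in> L\<rbrakk> \<Longrightarrow> bracket x y \<in> L"
    and bracket_add_left:
      "\<lbrakk>x \<in> L; y \<in> L; z \<in> L\<rbrakk> \<Longrightarrow> bracket (x + y) z = bracket x z + bracket y z"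
    and bracket_add_right:
      "\<lbrakk>x \<in> L; y \<in> L; z \<in> L\<rbrakk> \<Longrightarrow> bracket x (y + z) = bracket x y + bracket x z"
    and bracket_scale_left:
      "\<lbrakk>x \<in> L; y \<in> L\<rbrakk> \<Longrightarrow> bracket (scale c x) y = scale c (bracket x y)"
    and bracket_scale_right:
      "\<lbrakk>x \<in> L; y \<in> L\<rbrakk> \<Longrightarrow> bracket x (scale c y) = scale c (bracket x y)"
    and bracket_self: "x \<in> L \<Longrightarrow> bracket x x = 0"
    and jacobi: "\<lbrakk>x \<in> L; y \<in> L; z \<in> L\<rbrakk> \<Longrightarrow>
      bracket x (bracket y z) + bracket y (bracket z x) + bracket z (bracket x y) = 0"

definition lie_ideal ::
  "('k::field \<Rightarrow> 'g::ab_group_add \<Rightarrow> 'g) \<Rightarrow> ('g \<Rightarrow> 'g \<Rightarrow> 'g) \<Rightarrow> 'g set \<Rightarrow> 'g set \<Rightarrow> bool"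
  where "lie_ideal scale bracket L I \<longleftrightarrow>
    I \<subseteq> L \<and> module.subspace scale I \<and> (\<forall>x\<in>L. \<forall>y\<in>I. bracket x y \<in> I)"

definition lie_ideal_generated ::
  "('k::field \<Rightarrow> 'g::ab_group_add \<Rightarrow> 'g) \<Rightarrow> ('g \<Rightarrow> 'g \<Rightarrow> 'g) \<Rightarrow> 'g set \<Rightarrow> 'g set \<Rightarrow> 'g set"
  where "lie_ideal_generated scale bracket L S = \<Inter>{I. lie_ideal scale bracket L I \<and> S \<subseteq> I}"

text \<open>The subspace \<open>[A, B]\<close>: the linear span of the brackets, not just the set of brackets.\<close>

definition bracket_span ::
  "('k::field \<Rightarrow> 'g::ab_group_add \<Rightarrow> 'g) \<Rightarrow> ('g \<Rightarrow> 'g \<Rightarrow> 'g) \<Rightarrow> 'g set \<Rightarrow> 'g set \<Rightarrow> 'g set"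
  where "bracket_span scale bracket A B = module.span scale {bracket a b |a b. a \<in> A \<and> b \<in> B}"

primrec lower_central_series ::
  "('k::field \<Rightarrow> 'g::ab_group_add \<Rightarrow> 'g) \<Rightarrow> ('g \<Rightarrow> 'g \<Rightarrow> 'g) \<Rightarrow> 'g set \<Rightarrow> nat \<Rightarrow> 'g set"
  where
    "lower_central_series scale bracket L 0 = L"
  | "lower_central_series scale bracket L (Suc m) =
       bracket_span scale bracket L (lower_central_series scale bracket L m)"

primrec derived_series ::
  "('k::field \<Rightarrow> 'g::ab_group_add \<Rightarrow> 'g) \<Rightarrow> ('g \<Rightarrow> 'g \<Rightarrow> 'g) \<Rightarrow> 'g set \<Rightarrow> nat \<Rightarrow> 'g set"
  where
    "derived_series scale bracket L 0 = L"
  | "derived_series scale bracket L (Suc m) =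
       bracket_span scale bracket
         (derived_series scale bracket L m) (derived_series scale bracket L m)"

definition lie_solvable ::
  "('k::field \<Rightarrow> 'g::ab_group_add \<Rightarrow> 'g) \<Rightarrow> ('g \<Rightarrow> 'g \<Rightarrow> 'g) \<Rightarrow> 'g set \<Rightarrow> bool"
  where "lie_solvable scale bracket L \<longleftrightarrow>
    lie_algebra scale bracket L \<and> (\<exists>m. derived_series scale bracket L m = {0})"

definition linear_map_on ::
  "('k::field \<Rightarrow> 'v::ab_group_add \<Rightarrow> 'v) \<Rightarrow> 'v set \<Rightarrow>
   ('k \<Rightarrow> 'w::ab_group_add \<Rightarrow> 'w) \<Rightarrow> 'w set \<Rightarrow> ('v \<Rightarrow> 'w) \<Rightarrow> bool"
  where "linear_map_on s1 V s2 W T \<longleftrightarrow>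
    T ` V \<subseteq> W \<and>
    (\<forall>u\<in>V. \<forall>v\<in>V. T (u + v) = T u + T v) \<and>
    (\<forall>c. \<forall>v\<in>V. T (s1 c v) = s2 c (T v))"

definition lie_hom ::
  "('k::field \<Rightarrow> 'g::ab_group_add \<Rightarrow> 'g) \<Rightarrow> ('g \<Rightarrow> 'g \<Rightarrow> 'g) \<Rightarrow> 'g set \<Rightarrow>
   ('k \<Rightarrow> 'h::ab_group_add \<Rightarrow> 'h) \<Rightarrow> ('h \<Rightarrow> 'h \<Rightarrow> 'h) \<Rightarrow> 'h set \<Rightarrow> ('g \<Rightarrow> 'h) \<Rightarrow> bool"
  where "lie_hom s1 b1 L1 s2 b2 L2 h \<longleftrightarrow>
    linear_map_on s1 L1 s2 L2 h \<and>
    (\<forall>x\<in>L1. \<forall>y\<in>L1. h (b1 x y) = b2 (h x) (h y))"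


section \<open>The free Lie algebra\<close>

text \<open>
  Lie algebra expressions in the generators indexed by \<open>'n\<close>, modulo the least congruence
  that contains the axioms of a Lie algebra over \<open>'k\<close>.
\<close>

datatype ('k, 'n) lie_term =
    Gen 'n
  | Zero
  | Add "('k, 'n) lie_term" "('k, 'n) lie_term"
  | Scale 'k "('k, 'n) lie_term"
  | Bracket "('k, 'n) lie_term" "('k, 'n) lie_term"

inductive lie_eq :: "('k::field, 'n) lie_term \<Rightarrow> ('k, 'n) lie_term \<Rightarrow> bool" where
  refl: "lie_eq t t"
| sym: "lie_eq t u \<Longrightarrow> lie_eq u t"
| trans: "lie_eq t u \<Longrightarrow> lie_eq u v \<Longrightarrow> lie_eq t v"
| cong_Add: "lie_eq t t' \<Longrightarrow> lie_eq u u' \<Longrightarrow> lie_eq (Add t u) (Add t' u')"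
| cong_Scale: "lie_eq t t' \<Longrightarrow> lie_eq (Scale c t) (Scale c t')"
| cong_Bracket: "lie_eq t t' \<Longrightarrow> lie_eq u u' \<Longrightarrow> lie_eq (Bracket t u) (Bracket t' u')"
| add_assoc: "lie_eq (Add (Add t u) v) (Add t (Add u v))"
| add_commute: "lie_eq (Add t u) (Add u t)"
| add_zero: "lie_eq (Add Zero t) t"
| add_inverse: "lie_eq (Add (Scale (- 1) t) t) Zero"
| scale_add_right: "lie_eq (Scale c (Add t u)) (Add (Scale c t) (Scale c u))"
| scale_add_left: "lie_eq (Scale (c + d) t) (Add (Scale c t) (Scale d t))"
| scale_scale: "lie_eq (Scale c (Scale d t)) (Scale (c * d) t)"
| scale_one: "lie_eq (Scale 1 t) t"
| bracket_add_left: "lie_eq (Bracket (Add t u) v) (Add (Bracket t v) (Bracket u v))"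
| bracket_add_right: "lie_eq (Bracket t (Add u v)) (Add (Bracket t u) (Bracket t v))"
| bracket_scale_left: "lie_eq (Bracket (Scale c t) u) (Scale c (Bracket t u))"
| bracket_scale_right: "lie_eq (Bracket t (Scale c u)) (Scale c (Bracket t u))"
| bracket_self: "lie_eq (Bracket t t) Zero"
| jacobi: "lie_eq
    (Add (Add (Bracket t (Bracket u v)) (Bracket u (Bracket v t))) (Bracket v (Bracket t u))) Zero"

quotient_type (overloaded) ('k, 'n) free_lie = "('k::field, 'n) lie_term" / lie_eq
  by (rule equivpI; unfold reflp_def symp_def transp_def)
    (blast intro: lie_eq.refl lie_eq.sym lie_eq.trans)+

lift_definition free_gen :: "'n \<Rightarrow> ('k::field, 'n) free_lie" is Gen .

lift_definition free_scale :: "'k::field \<Rightarrow> ('k, 'n) free_lie \<Rightarrow> ('k, 'n) free_lie" is Scale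
  by (rule lie_eq.cong_Scale)

lift_definition free_bracket ::
  "('k::field, 'n) free_lie \<Rightarrow> ('k, 'n) free_lie \<Rightarrow> ('k, 'n) free_lie" is Bracket
  by (rule lie_eq.cong_Bracket)

instantiation free_lie :: (field, type) ab_group_add
begin

lift_definition zero_free_lie :: "('a, 'b) free_lie" is Zero .

lift_definition plus_free_lie :: "('a, 'b) free_lie \<Rightarrow> ('a, 'b) free_lie \<Rightarrow> ('a, 'b) free_lie" is Add
  by (rule lie_eq.cong_Add)

definition "- x = free_scale (- 1) (x :: ('a, 'b) free_lie)"

definition "x - y = x + (- y :: ('a, 'b) free_lie)"

instance
proof
  fix a b c :: "('a, 'b) free_lie"
  show "a + b + c = a + (b + c)" by transfer (rule lie_eq.add_assoc)
  show "a + b = b + a" by transfer (rule lie_eq.add_commute)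
  show "0 + a = a" by transfer (rule lie_eq.add_zero)
  show "- a + a = 0" unfolding uminus_free_lie_def by transfer (rule lie_eq.add_inverse)
  show "a - b = a + - b" by (rule minus_free_lie_def)
qed

end

lemma lie_algebra_free:
  "lie_algebra free_scale free_bracket (UNIV :: ('k::field, 'n) free_lie set)"
proof -
  interpret vector_space "free_scale :: 'k \<Rightarrow> ('k, 'n) free_lie \<Rightarrow> _"
    by (unfold_locales; transfer)
      (rule lie_eq.scale_add_right lie_eq.scale_add_left lie_eq.scale_scale lie_eq.scale_one)+
  have "free_bracket (x + y) z = free_bracket x z + free_bracket y z"
    and "free_bracket x (y + z) = free_bracket x y + free_bracket x z"
    and "free_bracket (free_scale c x) y = free_scale c (free_bracket x y)"
    and "free_bracket x (free_scale c y) = free_scale c (free_bracket x y)"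
    and "free_bracket x x = 0"
    and "free_bracket x (free_bracket y z) + free_bracket y (free_bracket z x) +
      free_bracket z (free_bracket x y) = 0"
    for c :: 'k and x y z :: "('k, 'n) free_lie"
    by (transfer, rule lie_eq.bracket_add_left lie_eq.bracket_add_right lie_eq.bracket_scale_left
        lie_eq.bracket_scale_right lie_eq.bracket_self lie_eq.jacobi)+
  then show ?thesis
    by unfold_locales simp_all
qed

primrec eval_lie_term ::
  "('k::field \<Rightarrow> 'g::ab_group_add \<Rightarrow> 'g) \<Rightarrow> ('g \<Rightarrow> 'g \<Rightarrow> 'g) \<Rightarrow> ('n \<Rightarrow> 'g) \<Rightarrow> ('k, 'n) lie_term \<Rightarrow> 'g"
  where
    "eval_lie_term s b g (Gen i) = g i"
  | "eval_lie_term s b g Zero = 0"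
  | "eval_lie_term s b g (Add t u) = eval_lie_term s b g t + eval_lie_term s b g u"
  | "eval_lie_term s b g (Scale c t) = s c (eval_lie_term s b g t)"
  | "eval_lie_term s b g (Bracket t u) = b (eval_lie_term s b g t) (eval_lie_term s b g u)"

lemma eval_lie_term_respects:
  assumes "lie_algebra s b L" and g: "range g \<subseteq> L" and "lie_eq t u"
  shows "eval_lie_term s b g t = eval_lie_term s b g u"
proof -
  interpret lie_algebra s b L by fact
  have mem [simp]: "eval_lie_term s b g t \<in> L" for t
    using g subspace_carrier
    by (induction t) (auto intro: bracket_closed subspace_0 subspace_add subspace_scale)
  note lie_simps = bracket_add_right bracket_add_left bracket_scale_left bracket_scale_right
    bracket_self jacobi
  from \<open>lie_eq t u\<close> show ?thesis
    by induction
      ((simp add: lie_simps scale_right_distrib scale_left_distrib; fail) |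
       (simp add: add_ac; fail))+
qed

theorem free_lie_universal:
  assumes "lie_algebra s b L" and g: "range g \<subseteq> L"
  shows "\<exists>!h. lie_hom free_scale free_bracket UNIV s b L h \<and> (\<forall>i. h (free_gen i) = g i)"
proof -
  interpret lie_algebra s b L by fact
  interpret F: lie_algebra free_scale free_bracket UNIV by (rule lie_algebra_free)
  define h where "h x = eval_lie_term s b g (rep_free_lie x)" for x
  have h_abs: "h (abs_free_lie t) = eval_lie_term s b g t" for t
    unfolding h_def
    by (intro eval_lie_term_respects[OF assms] rep_abs_rsp_left[OF Quotient3_free_lie] lie_eq.refl)
  have mem: "eval_lie_term s b g t \<in> L" for t
    using g subspace_carrier
    by (induction t) (auto intro: bracket_closed subspace_0 subspace_add subspace_scale)
  have h_add: "h (x + y) = h x + h y" for x y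
    by (induction x rule: free_lie.abs_induct; induction y rule: free_lie.abs_induct)
      (simp add: plus_free_lie.abs_eq h_abs)
  have h_scale: "h (free_scale c x) = s c (h x)" for c x
    by (induction x rule: free_lie.abs_induct) (simp add: free_scale.abs_eq h_abs)
  have h_bracket: "h (free_bracket x y) = b (h x) (h y)" for x y
    by (induction x rule: free_lie.abs_induct; induction y rule: free_lie.abs_induct)
      (simp add: free_bracket.abs_eq h_abs)
  have h_gen: "h (free_gen i) = g i" for i
    by (simp add: free_gen.abs_eq h_abs)
  have hom: "lie_hom free_scale free_bracket UNIV s b L h"
    unfolding lie_hom_def linear_map_on_def
    using h_add h_scale h_bracket mem by (auto simp: h_def)
  show ?thesis
  proof (rule ex1I[of _ h])
    show "lie_hom free_scale free_bracket UNIV s b L h \<and> (\<forall>i. h (free_gen i) = g i)"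
      using hom h_gen by simp
  next
    fix h' assume h': "lie_hom free_scale free_bracket UNIV s b L h' \<and> (\<forall>i. h' (free_gen i) = g i)"
    then have h'0: "h' 0 = 0"
      unfolding lie_hom_def linear_map_on_def by (metis F.scale_zero_left UNIV_I scale_zero_left)
    have "h' (abs_free_lie t) = h (abs_free_lie t)" for t
    proof (induction t)
      case (Gen i)
      then show ?case using h' h_gen by (simp add: free_gen.abs_eq[symmetric])
    next
      case Zero
      then show ?case using h'0 h_abs[of Zero] by (simp add: zero_free_lie.abs_eq[symmetric])
    next
      case (Add t u)
      then show ?case using h' h_add
        by (simp add: plus_free_lie.abs_eq[symmetric] lie_hom_def linear_map_on_def)
    next
      case (Scale c t)
      then show ?case using h' h_scale
        by (simp add: free_scale.abs_eq[symmetric] lie_hom_def linear_map_on_def)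
    next
      case (Bracket t u)
      then show ?case using h' h_bracket
        by (simp add: free_bracket.abs_eq[symmetric] lie_hom_def linear_map_on_def)
    qed
    then show "h' = h" by (intro ext) (rule free_lie.abs_induct)
  qed
qed


section \<open>The Yang--Mills algebra\<close>

definition ym_relation :: "'n \<Rightarrow> ('k::field, 'n::finite) free_lie"
  where "ym_relation j =
    (\<Sum>i\<in>UNIV. free_bracket (free_gen i) (free_bracket (free_gen i) (free_gen j)))"

definition ym_ideal :: "('k::field, 'n::finite) free_lie set"
  where "ym_ideal = lie_ideal_generated free_scale free_bracket UNIV (range ym_relation)"

lemma lie_ideal_ym_ideal: "lie_ideal free_scale free_bracket UNIV ym_ideal"
proof -
  interpret F: lie_algebra free_scale free_bracket UNIV by (rule lie_algebra_free)
  show ?thesis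
    unfolding ym_ideal_def lie_ideal_generated_def lie_ideal_def F.subspace_def by auto
qed

lemma ym_ideal_closed:
  "0 \<in> ym_ideal"
  "x \<in> ym_ideal \<Longrightarrow> y \<in> ym_ideal \<Longrightarrow> x + y \<in> ym_ideal"
  "x \<in> ym_ideal \<Longrightarrow> free_scale c x \<in> ym_ideal"
  "x \<in> ym_ideal \<Longrightarrow> - x \<in> ym_ideal"
  "y \<in> ym_ideal \<Longrightarrow> free_bracket x y \<in> ym_ideal"
  "y \<in> ym_ideal \<Longrightarrow> free_bracket y x \<in> ym_ideal"
proof -
  interpret F: lie_algebra free_scale free_bracket UNIV by (rule lie_algebra_free)
  have sub: "F.subspace ym_ideal" and br: "\<And>x y. y \<in> ym_ideal \<Longrightarrow> free_bracket x y \<in> ym_ideal"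
    using lie_ideal_ym_ideal unfolding lie_ideal_def by auto
  show "0 \<in> ym_ideal"
    "x \<in> ym_ideal \<Longrightarrow> y \<in> ym_ideal \<Longrightarrow> x + y \<in> ym_ideal"
    "x \<in> ym_ideal \<Longrightarrow> free_scale c x \<in> ym_ideal"
    "x \<in> ym_ideal \<Longrightarrow> - x \<in> ym_ideal"
    by (rule F.subspace_0[OF sub] F.subspace_add[OF sub] F.subspace_scale[OF sub]
        F.subspace_neg[OF sub]; assumption)+
  show "y \<in> ym_ideal \<Longrightarrow> free_bracket x y \<in> ym_ideal" by (rule br)
  have "free_bracket x y + free_bracket y x = 0"
    using F.bracket_self[of "x + y"] F.bracket_self[of x] F.bracket_self[of y]
    by (simp add: F.bracket_add_left F.bracket_add_right add.commute)
  then have "free_bracket y x = - free_bracket x y"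
    by (metis add_eq_0_iff)
  then show "y \<in> ym_ideal \<Longrightarrow> free_bracket y x \<in> ym_ideal"
    using F.subspace_neg[OF sub br, of y x] by simp
qed

quotient_type (overloaded) ('k, 'n) ym =
  "('k::field, 'n::finite) free_lie" / "\<lambda>x y. x - y \<in> ym_ideal"
proof (rule equivpI; unfold reflp_def symp_def transp_def; intro allI impI)
  fix x y z :: "('k, 'n) free_lie"
  show "x - x \<in> ym_ideal" by (simp add: ym_ideal_closed)
  show "y - x \<in> ym_ideal" if "x - y \<in> ym_ideal"
    using ym_ideal_closed(4)[OF that] by simp
  show "x - z \<in> ym_ideal" if "x - y \<in> ym_ideal" "y - z \<in> ym_ideal"
    using ym_ideal_closed(2)[OF that] by simp
qed

lift_definition ym_scale :: "'k::field \<Rightarrow> ('k, 'n::finite) ym \<Rightarrow> ('k, 'n) ym" is free_scale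
proof -
  interpret F: lie_algebra free_scale free_bracket UNIV by (rule lie_algebra_free)
  show "free_scale c x - free_scale c y \<in> ym_ideal" if "x - y \<in> ym_ideal"
    for c :: 'k and x y :: "('k, 'n) free_lie"
    using ym_ideal_closed(3)[OF that, of c] by (simp add: F.scale_right_diff_distrib)
qed

lift_definition ym_bracket :: "('k::field, 'n::finite) ym \<Rightarrow> ('k, 'n) ym \<Rightarrow> ('k, 'n) ym"
  is free_bracket
proof -
  interpret F: lie_algebra free_scale free_bracket UNIV by (rule lie_algebra_free)
  fix x x' y y' :: "('k, 'n) free_lie"
  assume "x - x' \<in> ym_ideal" "y - y' \<in> ym_ideal"
  then have "free_bracket (x - x') y + free_bracket x' (y - y') \<in> ym_ideal"
    by (intro ym_ideal_closed)
  also have "free_bracket (x - x') y = free_bracket x y - free_bracket x' y"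
    using F.bracket_add_left[of "x - x'" x' y] by (simp add: algebra_simps)
  also have "free_bracket x' (y - y') = free_bracket x' y - free_bracket x' y'"
    using F.bracket_add_right[of x' "y - y'" y'] by (simp add: algebra_simps)
  finally show "free_bracket x y - free_bracket x' y' \<in> ym_ideal" by simp
qed

instantiation ym :: (field, finite) ab_group_add
begin

lift_definition zero_ym :: "('a, 'b) ym" is 0 .

lift_definition plus_ym :: "('a, 'b) ym \<Rightarrow> ('a, 'b) ym \<Rightarrow> ('a, 'b) ym" is "(+)"
  by (subst add_diff_add) (rule ym_ideal_closed(2))

lift_definition uminus_ym :: "('a, 'b) ym \<Rightarrow> ('a, 'b) ym" is uminus
proof -
  fix x y :: "('a, 'b) free_lie"
  assume "x - y \<in> ym_ideal"
  from ym_ideal_closed(4)[OF this] show "- x - - y \<in> ym_ideal" by simp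
qed

lift_definition minus_ym :: "('a, 'b) ym \<Rightarrow> ('a, 'b) ym \<Rightarrow> ('a, 'b) ym" is "(-)"
proof -
  fix x x' y y' :: "('a, 'b) free_lie"
  assume "x - x' \<in> ym_ideal" "y - y' \<in> ym_ideal"
  then have "(x - x') + - (y - y') \<in> ym_ideal" by (intro ym_ideal_closed)
  then show "x - y - (x' - y') \<in> ym_ideal" by (simp add: algebra_simps)
qed

instance
  by (intro_classes; transfer) (simp_all add: ym_ideal_closed algebra_simps)

end

lemma lie_algebra_ym:
  "lie_algebra ym_scale ym_bracket (UNIV :: ('k::field, 'n::finite) ym set)"
proof -
  interpret F: lie_algebra free_scale free_bracket "UNIV :: ('k, 'n) free_lie set"
    by (rule lie_algebra_free)
  interpret vector_space "ym_scale :: 'k \<Rightarrow> ('k, 'n) ym \<Rightarrow> _"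
    by (unfold_locales; transfer)
      (simp_all add: ym_ideal_closed F.scale_right_distrib F.scale_left_distrib)
  have "ym_bracket (x + y) z = ym_bracket x z + ym_bracket y z"
    and "ym_bracket x (y + z) = ym_bracket x y + ym_bracket x z"
    and "ym_bracket (ym_scale c x) y = ym_scale c (ym_bracket x y)"
    and "ym_bracket x (ym_scale c y) = ym_scale c (ym_bracket x y)"
    and "ym_bracket x x = 0"
    and "ym_bracket x (ym_bracket y z) + ym_bracket y (ym_bracket z x) +
      ym_bracket z (ym_bracket x y) = 0"
    for c :: 'k and x y z :: "('k, 'n) ym"
    by (transfer, simp add: ym_ideal_closed F.bracket_add_right F.bracket_add_left
        F.bracket_scale_left F.bracket_scale_right F.bracket_self F.jacobi)+
  then show ?thesis
    by unfold_locales simp_all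
qed


section \<open>The abelianization of the Yang--Mills algebra\<close>

abbreviation ym_C :: "nat \<Rightarrow> ('k::field, 'n::finite) ym set"
  where "ym_C \<equiv> lower_central_series ym_scale ym_bracket UNIV"

lemma ym_C1_closed:
  "0 \<in> ym_C 1"
  "x \<in> ym_C 1 \<Longrightarrow> y \<in> ym_C 1 \<Longrightarrow> x + y \<in> ym_C 1"
  "x \<in> ym_C 1 \<Longrightarrow> ym_scale c x \<in> ym_C 1"
  "x \<in> ym_C 1 \<Longrightarrow> - x \<in> ym_C 1"
proof -
  interpret Y: lie_algebra ym_scale ym_bracket UNIV by (rule lie_algebra_ym)
  show "0 \<in> ym_C 1"
    "x \<in> ym_C 1 \<Longrightarrow> y \<in> ym_C 1 \<Longrightarrow> x + y \<in> ym_C 1"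
    "x \<in> ym_C 1 \<Longrightarrow> ym_scale c x \<in> ym_C 1"
    "x \<in> ym_C 1 \<Longrightarrow> - x \<in> ym_C 1"
    unfolding One_nat_def lower_central_series.simps bracket_span_def
    by (rule Y.span_zero Y.span_add Y.span_scale Y.span_neg; assumption)+
qed

text \<open>The type \<open>ym_ab\<close> is the quotient vector space of \<open>ym\<close> by \<open>ym_C 1\<close>.\<close>

quotient_type (overloaded) ('k, 'n) ym_ab =
  "('k::field, 'n::finite) ym" / "\<lambda>x y. x - y \<in> ym_C 1"
  morphisms rep_ym_ab ym_class
proof (rule equivpI; unfold reflp_def symp_def transp_def; intro allI impI)
  fix x y z :: "('k, 'n) ym"
  show "x - x \<in> ym_C 1" using ym_C1_closed(1) by simp
  show "y - x \<in> ym_C 1" if "x - y \<in> ym_C 1"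
    using ym_C1_closed(4)[OF that] by simp
  show "x - z \<in> ym_C 1" if "x - y \<in> ym_C 1" "y - z \<in> ym_C 1"
    using ym_C1_closed(2)[OF that] by simp
qed

lift_definition ym_ab_scale :: "'k::field \<Rightarrow> ('k, 'n::finite) ym_ab \<Rightarrow> ('k, 'n) ym_ab" is ym_scale
proof -
  interpret Y: lie_algebra ym_scale ym_bracket UNIV by (rule lie_algebra_ym)
  show "ym_scale c x - ym_scale c y \<in> ym_C 1" if "x - y \<in> ym_C 1"
    for c :: 'k and x y :: "('k, 'n) ym"
    using ym_C1_closed(3)[OF that, of c] by (simp add: Y.scale_right_diff_distrib)
qed

instantiation ym_ab :: (field, finite) ab_group_add
begin

lift_definition zero_ym_ab :: "('a, 'b) ym_ab" is 0 .

lift_definition plus_ym_ab :: "('a, 'b) ym_ab \<Rightarrow> ('a, 'b) ym_ab \<Rightarrow> ('a, 'b) ym_ab" is "(+)"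
  by (subst add_diff_add) (rule ym_C1_closed(2))

lift_definition uminus_ym_ab :: "('a, 'b) ym_ab \<Rightarrow> ('a, 'b) ym_ab" is uminus
proof -
  fix x y :: "('a, 'b) ym"
  assume "x - y \<in> ym_C 1"
  from ym_C1_closed(4)[OF this] show "- x - - y \<in> ym_C 1" by simp
qed

lift_definition minus_ym_ab :: "('a, 'b) ym_ab \<Rightarrow> ('a, 'b) ym_ab \<Rightarrow> ('a, 'b) ym_ab" is "(-)"
proof -
  fix x x' y y' :: "('a, 'b) ym"
  assume "x - x' \<in> ym_C 1" "y - y' \<in> ym_C 1"
  then have "(x - x') + - (y - y') \<in> ym_C 1" by (intro ym_C1_closed)
  then show "x - y - (x' - y') \<in> ym_C 1" by (simp add: algebra_simps)
qed

instance
  by (intro_classes; transfer) (use ym_C1_closed(1) in \<open>simp_all add: algebra_simps\<close>)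

end

lemma vector_space_ym_ab: "vector_space ym_ab_scale"
proof -
  interpret Y: lie_algebra ym_scale ym_bracket UNIV by (rule lie_algebra_ym)
  show ?thesis
    by (unfold_locales; transfer)
      (use ym_C1_closed(1) in \<open>simp_all add: Y.scale_right_distrib Y.scale_left_distrib\<close>)
qed

definition ym_ab_dual :: "(('k::field, 'n::finite) ym_ab \<Rightarrow> 'k) set"
  where "ym_ab_dual = {f. Vector_Spaces.linear ym_ab_scale (*) f}"


section \<open>Representations\<close>

definition end_scale :: "('k::field \<Rightarrow> 'v::ab_group_add \<Rightarrow> 'v) \<Rightarrow> 'k \<Rightarrow> ('v \<Rightarrow> 'v) \<Rightarrow> ('v \<Rightarrow> 'v)"
  where "end_scale s c A = (\<lambda>v. s c (A v))"

definition commutator :: "('v::ab_group_add \<Rightarrow> 'v) \<Rightarrow> ('v \<Rightarrow> 'v) \<Rightarrow> ('v \<Rightarrow> 'v)"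
  where "commutator A B = (\<lambda>v. A (B v) - B (A v))"

text \<open>
  An endomorphism of the subspace \<open>V\<close> is encoded as a function on the ambient type that
  vanishes outside \<open>V\<close>.  Equality of functions is then equality of endomorphisms, and the
  pointwise vector space operations and the commutator preserve this encoding.
\<close>

definition gl :: "('k::field \<Rightarrow> 'v::ab_group_add \<Rightarrow> 'v) \<Rightarrow> 'v set \<Rightarrow> ('v \<Rightarrow> 'v) set"
  where "gl s V = {A. linear_map_on s V s V A \<and> (\<forall>v. v \<notin> V \<longrightarrow> A v = 0)}"

lemma lie_algebra_gl:
  fixes s :: "'k::field \<Rightarrow> 'v::ab_group_add \<Rightarrow> 'v"
  assumes "vector_space s" and "module.subspace s V"
  shows "lie_algebra (end_scale s) commutator (gl s V)"
proof -
  interpret vector_space s by fact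
  interpret E: vector_space "end_scale s"
    by unfold_locales (auto simp: end_scale_def plus_fun_def algebra_simps)
  have V0: "0 \<in> V" and Vadd: "\<And>u v. u \<in> V \<Longrightarrow> v \<in> V \<Longrightarrow> u + v \<in> V"
    and Vscale: "\<And>c v. v \<in> V \<Longrightarrow> s c v \<in> V" and Vdiff: "\<And>u v. u \<in> V \<Longrightarrow> v \<in> V \<Longrightarrow> u - v \<in> V"
    using assms(2) by (auto intro: subspace_0 subspace_add subspace_scale subspace_diff)
  have gl0: "A 0 = 0" if "A \<in> gl s V" for A
    using that V0 unfolding gl_def linear_map_on_def
    by (metis (mono_tags, lifting) mem_Collect_eq scale_zero_left)
  have glV: "A v \<in> V" if "A \<in> gl s V" for A v
    using that V0 unfolding gl_def linear_map_on_def by (cases "v \<in> V") auto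
  have gladd: "A (u + v) = A u + A v" if "A \<in> gl s V" "u \<in> V" "v \<in> V" for A u v
    using that unfolding gl_def linear_map_on_def by auto
  have glscale: "A (s c v) = s c (A v)" if "A \<in> gl s V" "v \<in> V" for A c v
    using that unfolding gl_def linear_map_on_def by auto
  have gldiff: "A (u - v) = A u - A v" if "A \<in> gl s V" "u \<in> V" "v \<in> V" for A u v
    using gladd[OF that(1) Vdiff[OF that(2,3)] that(3)] by (simp add: algebra_simps)
  have glout: "A v = 0" if "A \<in> gl s V" "v \<notin> V" for A v
    using that unfolding gl_def by auto
  show ?thesis
  proof unfold_locales
    show "E.subspace (gl s V)"
      unfolding E.subspace_def
      by (auto simp: gl_def linear_map_on_def end_scale_def zero_fun_def plus_fun_def
          image_subset_iff V0 Vadd Vscale algebra_simps)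
    show "commutator A B \<in> gl s V" if A: "A \<in> gl s V" and B: "B \<in> gl s V" for A B
    proof -
      have "commutator A B (u + v) = commutator A B u + commutator A B v"
        if "u \<in> V" "v \<in> V" for u v
        using that unfolding commutator_def
        by (simp add: gladd[OF A] gladd[OF B] glV[OF A] glV[OF B])
      moreover have "commutator A B (s c v) = s c (commutator A B v)" if "v \<in> V" for c v
        using that unfolding commutator_def
        by (simp add: glscale[OF A] glscale[OF B] glV[OF A] glV[OF B] scale_right_diff_distrib)
      moreover have "commutator A B v \<in> V" for v
        unfolding commutator_def by (intro Vdiff glV[OF A] glV[OF B])
      moreover have "commutator A B v = 0" if "v \<notin> V" for v
        using that unfolding commutator_def
        by (simp add: glout[OF A] glout[OF B] gl0[OF A] gl0[OF B])
      ultimately show ?thesis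
        unfolding gl_def linear_map_on_def by auto
    qed
  next
    fix A B C :: "'v \<Rightarrow> 'v" and c :: 'k
    assume A: "A \<in> gl s V" and B: "B \<in> gl s V" and C: "C \<in> gl s V"
    note simps = fun_eq_iff commutator_def end_scale_def zero_fun_def plus_fun_def
      gladd[OF A] gladd[OF B] gladd[OF C] gldiff[OF A] gldiff[OF B] gldiff[OF C]
      glscale[OF A] glscale[OF B] glV[OF A] glV[OF B] glV[OF C] scale_right_diff_distrib
    show "commutator (A + B) C = commutator A C + commutator B C"
      and "commutator A (B + C) = commutator A B + commutator A C"
      and "commutator (end_scale s c A) B = end_scale s c (commutator A B)"
      and "commutator A (end_scale s c B) = end_scale s c (commutator A B)"
      and "commutator A A = 0"
      and "commutator A (commutator B C) + commutator B (commutator C A) +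
        commutator C (commutator A B) = 0"
      by (simp_all add: simps)
  qed
qed

text \<open>
  A representation is a pair \<open>(V, \<phi>)\<close> with \<open>V\<close> a subspace of an ambient vector space with
  scaling \<open>s\<close>.  The represented Lie algebra occupies a whole type.
\<close>

definition lie_representation ::
  "('k::field \<Rightarrow> 'g::ab_group_add \<Rightarrow> 'g) \<Rightarrow> ('g \<Rightarrow> 'g \<Rightarrow> 'g) \<Rightarrow>
   ('k \<Rightarrow> 'v::ab_group_add \<Rightarrow> 'v) \<Rightarrow> 'v set \<times> ('g \<Rightarrow> 'v \<Rightarrow> 'v) \<Rightarrow> bool"
  where "lie_representation scale bracket s = (\<lambda>(V, \<phi>).
    vector_space s \<and> module.subspace s V \<and>
    lie_hom scale bracket UNIV (end_scale s) commutator (gl s V) \<phi>)"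

definition finite_dim_rep ::
  "('k::field \<Rightarrow> 'v::ab_group_add \<Rightarrow> 'v) \<Rightarrow> 'v set \<times> ('g \<Rightarrow> 'v \<Rightarrow> 'v) \<Rightarrow> bool"
  where "finite_dim_rep s = (\<lambda>(V, \<phi>). \<exists>B. finite B \<and> module.span s B = V)"

definition solvable_rep ::
  "('k::field \<Rightarrow> 'v::ab_group_add \<Rightarrow> 'v) \<Rightarrow> 'v set \<times> ('g \<Rightarrow> 'v \<Rightarrow> 'v) \<Rightarrow> bool"
  where "solvable_rep s = (\<lambda>(V, \<phi>). lie_solvable (end_scale s) commutator (range \<phi>))"

definition irreducible_rep ::
  "('k::field \<Rightarrow> 'v::ab_group_add \<Rightarrow> 'v) \<Rightarrow> 'v set \<times> ('g \<Rightarrow> 'v \<Rightarrow> 'v) \<Rightarrow> bool"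
  where "irreducible_rep s = (\<lambda>(V, \<phi>). V \<noteq> {0} \<and>
    (\<forall>W. module.subspace s W \<and> W \<subseteq> V \<and> (\<forall>x. \<forall>w\<in>W. \<phi> x w \<in> W) \<longrightarrow> W = {0} \<or> W = V))"

definition rep_iso ::
  "('k::field \<Rightarrow> 'v::ab_group_add \<Rightarrow> 'v) \<Rightarrow> ('k \<Rightarrow> 'w::ab_group_add \<Rightarrow> 'w) \<Rightarrow>
   'v set \<times> ('g \<Rightarrow> 'v \<Rightarrow> 'v) \<Rightarrow> 'w set \<times> ('g \<Rightarrow> 'w \<Rightarrow> 'w) \<Rightarrow> bool"
  where "rep_iso s1 s2 = (\<lambda>(V, \<phi>) (W, \<psi>). \<exists>T.
    linear_map_on s1 V s2 W T \<and> bij_betw T V W \<and> (\<forall>x. \<forall>v\<in>V. T (\<phi> x v) = \<psi> x (T v)))"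

type_synonym ('k, 'n, 'v) ym_rep = "'v set \<times> (('k, 'n) ym \<Rightarrow> 'v \<Rightarrow> 'v)"

definition ym_irr_solvable_reps ::
  "('k::field \<Rightarrow> 'v::ab_group_add \<Rightarrow> 'v) \<Rightarrow> ('k, 'n::finite, 'v) ym_rep set"
  where "ym_irr_solvable_reps s =
    {R. lie_representation ym_scale ym_bracket s R \<and> finite_dim_rep s R \<and>
        solvable_rep s R \<and> irreducible_rep s R}"

definition ym_rep_iso_rel ::
  "('k::field \<Rightarrow> 'v::ab_group_add \<Rightarrow> 'v) \<Rightarrow>
   (('k, 'n::finite, 'v) ym_rep \<times> ('k, 'n, 'v) ym_rep) set"
  where "ym_rep_iso_rel s =
    {(R, R'). R \<in> ym_irr_solvable_reps s \<and> R' \<in> ym_irr_solvable_reps s \<and> rep_iso s s R R'}"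

text \<open>
  The isomorphism classes of irreducible solvable finite dimensional representations whose
  underlying space lies in the ambient vector space \<open>s\<close>.  An infinite dimensional ambient
  space contains a copy of every finite dimensional space and so yields all classes.
\<close>

definition ym_irr_solvable_classes ::
  "('k::field \<Rightarrow> 'v::ab_group_add \<Rightarrow> 'v) \<Rightarrow> ('k, 'n::finite, 'v) ym_rep set set"
  where "ym_irr_solvable_classes s = ym_irr_solvable_reps s // ym_rep_iso_rel s"

text \<open>
  The one dimensional representation attached to a linear form on the abelianization.
  Its space is the field itself, in general a different ambient type than that of \<open>s\<close>;
  \<open>ym_char_class s f\<close> is its isomorphism class within \<open>s\<close>.
\<close>

definition ym_char_rep :: "(('k::field, 'n::finite) ym_ab \<Rightarrow> 'k) \<Rightarrow> ('k, 'n, 'k) ym_rep"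
  where "ym_char_rep f = (UNIV, \<lambda>x c. f (ym_class x) * c)"

definition ym_char_class ::
  "('k::field \<Rightarrow> 'v::ab_group_add \<Rightarrow> 'v) \<Rightarrow> (('k, 'n::finite) ym_ab \<Rightarrow> 'k) \<Rightarrow> ('k, 'n, 'v) ym_rep set"
  where "ym_char_class s f = {R \<in> ym_irr_solvable_reps s. rep_iso s (*) R (ym_char_rep f)}"

end

theory Submission
  imports Defs
begin

text \<open>
  The first half is the theorem of Lie in the form needed for irreducible modules: a solvable Lie
  algebra \<open>G\<close> of endomorphisms of a nonzero finite dimensional space \<open>V\<close> that leaves no
  proper nonzero subspace invariant consists of scalars, so every line is invariant and \<open>V\<close>
  is itself a line.  The argument descends along the derived series.  Suppose that
  \<open>D\<^sub>k\<^sub>+\<^sub>1\<close> acts by scalars.  Commutators of elements of \<open>D\<^sub>k\<close> are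
  then scalars, and in characteristic zero a commutator that is a scalar vanishes
  (\<open>commute_if_commutator_scalar\<close>).  Hence \<open>D\<^sub>k\<close> is a commuting family, and over an
  algebraically closed field it has a common eigenvector.  The common eigenvectors with the same
  eigenvalues form a weight space, which is \<open>G\<close>-invariant because \<open>D\<^sub>k\<close> is an ideal
  and the eigenvalue of \<open>[h, x]\<close> is zero for \<open>h \<in> D\<^sub>k\<close> and \<open>x \<in> G\<close>.  By
  irreducibility the weight space is all of \<open>V\<close>, so \<open>D\<^sub>k\<close> acts by scalars.

  Both vanishing statements are instances of \<open>commutator_kills_common_eigenvector\<close>, which is
  proved without traces: on the Krylov sequence \<open>v, x v, x\<^sup>2 v, \<dots>\<close> the operator
  \<open>h\<close> is triangular, with superdiagonal entries \<open>1 \<mu>, 2 \<mu>, 3 \<mu>, \<dots>\<close> where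
  \<open>[h, x] v = \<mu> v\<close>.  If \<open>\<mu>\<close> were nonzero, a linear dependence in the sequence could
  be pushed down one step at a time until it read \<open>v = 0\<close>.

  The second half is the classification of the one dimensional representations.  Such a
  representation acts through scalars \<open>g x\<close>; scalars commute, so \<open>g\<close> kills all brackets and
  factors through the abelianization.  Conversely every linear form on the abelianization acts on
  any given line.  Two one dimensional representations, even in different ambient spaces, are
  isomorphic exactly when their linear forms agree, so the form is a complete invariant of the
  isomorphism class.
\<close>

section \<open>Endomorphisms of a finite dimensional space\<close>

locale finite_dim_endomorphisms = vector_space scale
  for scale :: "'k::{alg_closed_field, field_char_0} \<Rightarrow> 'v::ab_group_add \<Rightarrow> 'v" +
  fixes V :: "'v set"
  assumes finitely_spanned: "\<exists>B. finite B \<and> span B = V"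
begin

lemma subspace_V: "subspace V"
  using finitely_spanned subspace_span by blast

lemma gl_mem: "A \<in> gl scale V \<Longrightarrow> v \<in> V \<Longrightarrow> A v \<in> V"
  and gl_add: "A \<in> gl scale V \<Longrightarrow> u \<in> V \<Longrightarrow> v \<in> V \<Longrightarrow> A (u + v) = A u + A v"
  and gl_scale: "A \<in> gl scale V \<Longrightarrow> v \<in> V \<Longrightarrow> A (scale c v) = scale c (A v)"
  and gl_outside: "A \<in> gl scale V \<Longrightarrow> v \<notin> V \<Longrightarrow> A v = 0"
  unfolding gl_def linear_map_on_def by auto

lemma gl_zero: "A \<in> gl scale V \<Longrightarrow> A 0 = 0"
  using gl_scale[of A 0 0] subspace_0[OF subspace_V] by simp

lemma gl_diff: "A \<in> gl scale V \<Longrightarrow> u \<in> V \<Longrightarrow> v \<in> V \<Longrightarrow> A (u - v) = A u - A v"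
  using gl_add[of A "u - v" v] subspace_diff[OF subspace_V] by (simp add: eq_diff_eq)

lemma gl_maps_span:
  assumes A: "A \<in> gl scale V" and X: "X \<subseteq> V" and T: "subspace T" "A ` X \<subseteq> T" and u: "u \<in> span X"
  shows "A u \<in> T"
proof -
  have "subspace {u \<in> V. A u \<in> T}"
    using T(1) subspace_V A by (auto simp: subspace_def gl_zero gl_add gl_scale)
  then have "span X \<subseteq> {u \<in> V. A u \<in> T}"
    by (intro span_minimal) (use X T in auto)
  with u show ?thesis by auto
qed

lemma iterate_mem: "A \<in> gl scale V \<Longrightarrow> v \<in> V \<Longrightarrow> (A ^^ n) v \<in> V"
  by (induction n) (auto intro: gl_mem)

text \<open>
  A sequence without such an index would have linearly independent initial segments of every length,
  contradicting the finite spanning set.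
\<close>

lemma sequence_dependent:
  fixes u :: "nat \<Rightarrow> 'v"
  assumes u: "\<And>n. u n \<in> V"
  shows "\<exists>n. u n \<in> span (u ` {..<n})"
proof (rule ccontr)
  assume *: "\<nexists>n. u n \<in> span (u ` {..<n})"
  obtain B where B: "finite B" "span B = V"
    using finitely_spanned by blast
  have indep: "independent (u ` {..<n}) \<and> card (u ` {..<n}) = n" for n :: nat
  proof (induction n)
    case (Suc n)
    have fresh: "u n \<notin> span (u ` {..<n})"
      using * by simp
    then have "u n \<notin> u ` {..<n}"
      by (metis span_base)
    with Suc independent_insertI[OF fresh] show ?case
      by (simp add: lessThan_Suc)
  qed (simp add: independent_empty)
  have "u ` {..<Suc (card B)} \<subseteq> span B"
    using u B by auto
  with independent_span_bound[OF B(1)] indep[of "Suc (card B)"] show False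
    by (metis not_less_eq_eq order_refl)
qed

text \<open>
  A basis of \<open>U\<close> together with a vector of \<open>W\<close> outside \<open>U\<close> is independent, and the
  dimension of \<open>W\<close> is the cardinality of a finite set because \<open>W\<close> lies in \<open>V\<close>.
\<close>

lemma dim_psubset:
  assumes "subspace U" "U \<subset> W" "W \<subseteq> V"
  shows "dim U < dim W"
proof -
  obtain B where B: "finite B" "span B = V"
    using finitely_spanned by blast
  obtain w where w: "w \<in> W" "w \<notin> U"
    using assms by auto
  obtain C where C: "C \<subseteq> U" "independent C" "U \<subseteq> span C" "card C = dim U"
    by (rule basis_exists)
  obtain D where D: "D \<subseteq> W" "independent D" "W \<subseteq> span D" "card D = dim W"
    by (rule basis_exists)
  have "span C \<subseteq> U"
    using C(1) assms(1) by (intro span_minimal)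
  with w have "w \<notin> span C" by auto
  then have ind: "independent (insert w C)"
    by (rule independent_insertI[OF _ C(2)])
  have "finite D"
    using independent_span_bound[OF B(1) D(2)] D(1) B(2) assms(3) by auto
  then have "finite (insert w C) \<and> card (insert w C) \<le> card D"
    by (intro independent_span_bound[OF _ ind]) (use w C D assms in auto)
  moreover have "w \<notin> C"
    using w C by auto
  ultimately show ?thesis
    using C D by auto
qed

text \<open>
  This is \<open>p(A) v\<close> by the Horner scheme.  The values are vectors and not operators, so
  that a linear dependence among the vectors \<open>A\<^sup>i v\<close> is a polynomial relation.
\<close>

definition poly_action :: "('v \<Rightarrow> 'v) \<Rightarrow> 'v \<Rightarrow> 'k poly \<Rightarrow> 'v"
  where "poly_action A v p = fold_coeffs (\<lambda>c u. scale c v + A u) p 0"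

context
  fixes A :: "'v \<Rightarrow> 'v" and v :: 'v
  assumes A: "A \<in> gl scale V" and v: "v \<in> V"
begin

lemma poly_action_0 [simp]: "poly_action A v 0 = 0"
  by (simp add: poly_action_def)

lemma poly_action_pCons [simp]:
  "poly_action A v (pCons c p) = scale c v + A (poly_action A v p)"
  by (cases "p = 0 \<and> c = 0") (auto simp: poly_action_def gl_zero[OF A])

lemma poly_action_mem: "poly_action A v p \<in> V"
  using subspace_V v
  by (induction p) (auto intro: subspace_0 subspace_add subspace_scale gl_mem[OF A])

lemma poly_action_add: "poly_action A v (p + q) = poly_action A v p + poly_action A v q"
  by (induction p q rule: poly_induct2)
    (simp_all add: gl_add[OF A] poly_action_mem scale_left_distrib add_ac)

lemma poly_action_smult: "poly_action A v (smult c p) = scale c (poly_action A v p)"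
  by (induction p) (simp_all add: gl_scale[OF A] poly_action_mem scale_right_distrib)

lemma poly_action_monom: "poly_action A v (monom 1 n) = (A ^^ n) v"
  by (induction n) (simp_all add: monom_0 monom_Suc gl_zero[OF A])

lemma annihilating_polynomial: "\<exists>p. p \<noteq> 0 \<and> poly_action A v p = 0"
proof -
  obtain n where n: "(A ^^ n) v \<in> span ((\<lambda>i. (A ^^ i) v) ` {..<n})"
    using sequence_dependent[of "\<lambda>i. (A ^^ i) v"] iterate_mem[OF A v] by blast
  \<comment> \<open>The condition on the coefficient keeps the relation found below nontrivial: subtracting such
    a polynomial from the monomial of degree \<open>n\<close> leaves coefficient one in degree \<open>n\<close>.\<close>
  let ?T = "poly_action A v ` {p. coeff p n = 0}"
  have "subspace ?T"
    unfolding subspace_def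
  proof (intro conjI ballI allI)
    show "0 \<in> ?T"
      by (intro image_eqI[of _ _ 0]) auto
    show "x + y \<in> ?T" if "x \<in> ?T" "y \<in> ?T" for x y
      using that by (auto simp flip: poly_action_add)
    show "scale c x \<in> ?T" if "x \<in> ?T" for c x
      using that by (auto simp flip: poly_action_smult)
  qed
  then have "span ((\<lambda>i. (A ^^ i) v) ` {..<n}) \<subseteq> ?T"
    by (intro span_minimal) (auto simp flip: poly_action_monom)
  with n obtain p where p: "(A ^^ n) v = poly_action A v p" "coeff p n = 0"
    by auto
  have "poly_action A v (monom 1 n + smult (- 1) p) = 0"
    by (simp only: poly_action_add poly_action_smult poly_action_monom p) simp
  moreover have "coeff (monom 1 n + smult (- 1) p) n \<noteq> 0"
    using p by simp
  ultimately show ?thesis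
    by (metis coeff_0)
qed

end

text \<open>
  Take a nonzero polynomial \<open>p\<close> of least degree with \<open>p(A) w = 0\<close>, and split off a
  root, \<open>p = (X - c) q\<close>.  By minimality \<open>q(A) w\<close> is nonzero, and \<open>A - c\<close> kills it.
\<close>

lemma eigenvector_exists:
  assumes A: "A \<in> gl scale V" and W: "subspace W" "W \<subseteq> V" "W \<noteq> {0}" and inv: "A ` W \<subseteq> W"
  shows "\<exists>v\<in>W. v \<noteq> 0 \<and> (\<exists>c. A v = scale c v)"
proof -
  obtain w where w: "w \<in> W" "w \<noteq> 0"
    using W subspace_0 by blast
  then have wV: "w \<in> V"
    using W by auto
  note act = poly_action_pCons[OF A wV] poly_action_add[OF A wV] poly_action_smult[OF A wV]
  have act_W: "poly_action A w p \<in> W" for p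
    using w(1) inv subspace_0[OF W(1)]
    by (induction p)
      (auto simp: poly_action_0[OF A wV] act intro!: subspace_add[OF W(1)] subspace_scale[OF W(1)])
  obtain p where p: "p \<noteq> 0" "poly_action A w p = 0"
    and min: "\<And>q. q \<noteq> 0 \<Longrightarrow> poly_action A w q = 0 \<Longrightarrow> degree p \<le> degree q"
  proof -
    let ?ann = "\<lambda>p. p \<noteq> 0 \<and> poly_action A w p = 0"
    obtain p0 where "?ann p0"
      using annihilating_polynomial[OF A wV] by blast
    from ex_has_least_nat[of ?ann, OF this, of degree] show ?thesis
      using that by blast
  qed
  have "degree p > 0"
  proof (rule ccontr)
    assume "\<not> degree p > 0"
    then obtain c where "p = [:c:]"
      by (metis degree_eq_zeroE gr0I)
    then show False
      using p w gl_zero[OF A] by (simp add: act poly_action_0[OF A wV])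
  qed
  then obtain c where "poly p c = 0"
    using alg_closed_imp_poly_has_root by blast
  then obtain q where q: "p = [:- c, 1:] * q"
    unfolding poly_eq_0_iff_dvd by (elim dvdE)
  have "q \<noteq> 0"
    using p(1) unfolding q by auto
  then have "degree q < degree p"
    unfolding q by (subst degree_mult_eq) auto
  with min[OF \<open>q \<noteq> 0\<close>] have "poly_action A w q \<noteq> 0"
    by linarith
  moreover have "poly_action A w p = scale (- c) (poly_action A w q) + A (poly_action A w q)"
  proof -
    have "p = smult (- c) q + pCons 0 q"
      unfolding q by simp
    then show ?thesis
      by (simp only: act) simp
  qed
  with p(2) have "A (poly_action A w q) = scale c (poly_action A w q)"
    by simp
  ultimately show ?thesis
    using act_W by blast
qed

text \<open>
  Eigenspaces of one operator are invariant under operators commuting with it.  Hence on a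
  nonzero invariant subspace of least dimension every operator of the family is a scalar.
\<close>

lemma common_eigenvector_of_commuting:
  assumes S: "S \<subseteq> gl scale V" and V: "V \<noteq> {0}"
    and comm: "\<And>a b v. a \<in> S \<Longrightarrow> b \<in> S \<Longrightarrow> v \<in> V \<Longrightarrow> a (b v) = b (a v)"
  shows "\<exists>v\<in>V. v \<noteq> 0 \<and> (\<forall>a\<in>S. \<exists>c. a v = scale c v)"
proof -
  let ?P = "\<lambda>W. subspace W \<and> W \<subseteq> V \<and> W \<noteq> {0} \<and> (\<forall>a\<in>S. a ` W \<subseteq> W)"
  have "?P V"
    using subspace_V V S by (auto intro: gl_mem)
  from ex_has_least_nat[of ?P, OF this, of dim]
  obtain W where W: "?P W" and min: "\<And>U. ?P U \<Longrightarrow> dim W \<le> dim U"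
    by (elim exE conjE) blast
  obtain w where w: "w \<in> W" "w \<noteq> 0"
    using W subspace_0 by blast
  have "\<exists>c. a w = scale c w" if a: "a \<in> S" for a
  proof -
    have a_gl: "a \<in> gl scale V"
      using a S by blast
    obtain u c where u: "u \<in> W" "u \<noteq> 0" "a u = scale c u"
      using eigenvector_exists[OF a_gl, of W] W a by auto
    let ?U = "{v \<in> W. a v = scale c v}"
    have W_V: "u \<in> W \<Longrightarrow> u \<in> V" for u
      using W by blast
    have W_sub: "subspace W"
      using W by blast
    have sub: "subspace ?U"
      unfolding subspace_def
      using subspace_0[OF W_sub] subspace_add[OF W_sub] subspace_scale[OF W_sub]
      by (simp add: gl_zero[OF a_gl] gl_add[OF a_gl] gl_scale[OF a_gl] W_V scale_right_distrib
          mult.commute)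
    have "b v \<in> ?U" if b: "b \<in> S" and v: "v \<in> ?U" for b v
    proof -
      have vV: "v \<in> V"
        using v W_V by simp
      have b_gl: "b \<in> gl scale V"
        using b S by blast
      have "a (b v) = scale c (b v)"
        using comm[OF a b vV] v gl_scale[OF b_gl vV] by simp
      moreover have "b v \<in> W"
        using v b W by blast
      ultimately show ?thesis
        by simp
    qed
    moreover have "?U \<subseteq> V" "?U \<noteq> {0}"
      using u W_V by auto
    ultimately have "dim W \<le> dim ?U"
      by (intro min) (use sub in blast)
    then have "\<not> ?U \<subset> W"
      using dim_psubset[OF sub, of W] W by auto
    then have "?U = W"
      by blast
    then show ?thesis
      using w(1) by blast
  qed
  moreover have "w \<in> V"
    using w(1) W by blast
  ultimately show ?thesis
    using w(2) by blast
qed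

text \<open>
  This is the step where characteristic zero enters.  The hypothesis on \<open>S\<close> is
  stability under \<open>[\<cdot>, x]\<close>, because the lemma is used both for an ideal and, with
  \<open>x = b\<close>, for \<open>{a, [a, b], 0}\<close> when \<open>[a, b]\<close> is a scalar.  If \<open>[h, x]\<close> had the
  eigenvalue \<open>\<mu> \<noteq> 0\<close> at \<open>v\<close>, then \<open>h\<close> minus its eigenvalue would carry any linear dependence among
  the vectors \<open>x\<^sup>i v\<close> to a shorter one, and finally to \<open>v = 0\<close>.
\<close>

lemma commutator_kills_common_eigenvector:
  assumes S: "S \<subseteq> gl scale V" and x: "x \<in> gl scale V"
    and ideal: "\<And>h. h \<in> S \<Longrightarrow> commutator h x \<in> S"
    and v: "v \<in> V" "v \<noteq> 0" and eig: "\<And>h. h \<in> S \<Longrightarrow> \<exists>c. h v = scale c v"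
    and h: "h \<in> S"
  shows "commutator h x v = 0"
proof -
  obtain l where l: "\<And>h. h \<in> S \<Longrightarrow> h v = scale (l h) v"
    using eig by metis
  define y where "y i = (x ^^ i) v" for i
  define P where "P n = span (y ` {..<n})" for n
  have yV: "y i \<in> V" for i
    unfolding y_def by (rule iterate_mem[OF x v(1)])
  have y_Suc: "y (Suc i) = x (y i)" for i
    by (simp add: y_def)
  have P_sub: "subspace (P n)" for n
    by (simp add: P_def)
  have y_P: "i < n \<Longrightarrow> y i \<in> P n" for i n
    unfolding P_def by (auto intro: span_base)
  have P_mono: "m \<le> n \<Longrightarrow> P m \<subseteq> P n" for m n
    unfolding P_def by (intro span_mono) auto
  have x_P: "u \<in> P n \<Longrightarrow> x u \<in> P (Suc n)" for u n
    unfolding P_def[of n]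
    by (rule gl_maps_span[OF x _ P_sub]) (auto simp: yV y_P simp flip: y_Suc)
  have step: "h (y (Suc n)) - scale c (y (Suc n)) =
      x (h (y n) - scale c (y n)) + commutator h x (y n)" if "h \<in> S" for h c n
  proof -
    have "h \<in> gl scale V"
      using that S by blast
    then have "h (y n) \<in> V"
      by (rule gl_mem[OF _ yV])
    then show ?thesis
      using gl_diff[OF x, of "h (y n)" "scale c (y n)"] gl_scale[OF x yV] yV
        subspace_scale[OF subspace_V]
      by (simp add: y_Suc commutator_def)
  qed
  \<comment> \<open>Both claims about \<open>h\<close> come from \<open>h x = x h + [h, x]\<close>, applied to \<open>y n\<close>.
    Generality in \<open>h\<close> lets the induction hypothesis be used for \<open>[h, x]\<close> too.\<close>
  have triangular: "h (y n) - scale (l h) (y n) \<in> P n" if "h \<in> S" for h n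
    using that
  proof (induction n arbitrary: h)
    case 0
    then show ?case
      using l subspace_0[OF P_sub] by (simp add: y_def)
  next
    case (Suc n)
    let ?z = "commutator h x"
    have "?z (y n) - scale (l ?z) (y n) \<in> P (Suc n)"
      using Suc.IH[OF ideal[OF Suc.prems]] P_mono[of n "Suc n"] by auto
    from subspace_add[OF P_sub this subspace_scale[OF P_sub y_P[OF lessI]]]
    have "?z (y n) \<in> P (Suc n)"
      by (metis diff_add_cancel)
    with x_P[OF Suc.IH[OF Suc.prems]] show ?case
      unfolding step[OF Suc.prems] by (intro subspace_add[OF P_sub])
  qed
  \<comment> \<open>Each passage of \<open>h\<close> across a factor \<open>x\<close> contributes one further summand \<open>\<mu>\<close>.\<close>
  define \<mu> where "\<mu> = l (commutator h x)"
  have superdiagonal: "h (y (Suc n)) - scale (l h) (y (Suc n)) - scale (of_nat (Suc n) * \<mu>) (y n) \<in> P n"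
    for n
  proof (induction n)
    case 0
    have "h (y 0) = scale (l h) (y 0)" "commutator h x (y 0) = scale \<mu> (y 0)"
      using l h ideal by (simp_all add: y_def \<mu>_def)
    then show ?case
      using step[OF h, of 0] subspace_0[OF P_sub] gl_zero[OF x] by simp
  next
    case (Suc n)
    let ?D = "h (y (Suc n)) - scale (l h) (y (Suc n))"
    have "?D \<in> V"
      using h S yV subspace_V by (auto intro: subspace_diff subspace_scale gl_mem)
    then have "x (?D - scale (of_nat (Suc n) * \<mu>) (y n)) =
        x ?D - scale (of_nat (Suc n) * \<mu>) (y (Suc n))"
      using gl_diff[OF x, of ?D] gl_scale[OF x yV] yV subspace_V
      by (simp add: y_Suc subspace_scale)
    with x_P[OF Suc.IH] have 1: "x ?D - scale (of_nat (Suc n) * \<mu>) (y (Suc n)) \<in> P (Suc n)"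
      by simp
    have 2: "commutator h x (y (Suc n)) - scale \<mu> (y (Suc n)) \<in> P (Suc n)"
      unfolding \<mu>_def by (rule triangular[OF ideal[OF h]])
    have "h (y (Suc (Suc n))) - scale (l h) (y (Suc (Suc n)))
          - scale (of_nat (Suc (Suc n)) * \<mu>) (y (Suc n)) =
        (x ?D - scale (of_nat (Suc n) * \<mu>) (y (Suc n)))
          + (commutator h x (y (Suc n)) - scale \<mu> (y (Suc n)))"
    proof -
      have "of_nat (Suc (Suc n)) * \<mu> = of_nat (Suc n) * \<mu> + \<mu>"
        by (simp add: algebra_simps)
      then show ?thesis
        unfolding step[OF h] by (simp add: scale_left_distrib del: of_nat_Suc)
    qed
    then show ?case
      using subspace_add[OF P_sub 1 2] by simp
  qed
  \<comment> \<open>Since \<open>h - l h\<close> lowers the filtration by one, it turns a dependence of \<open>y (Suc n)\<close> on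
    its predecessors into one of \<open>(n + 1) \<mu> y n\<close>; the factor is invertible.\<close>
  have descend: "y n \<in> P n" if "y (Suc n) \<in> P (Suc n)" "\<mu> \<noteq> 0" for n
  proof -
    have hD: "h u - scale (l h) u \<in> P n" if "u \<in> P (Suc n)" for u
    proof -
      have h_gl: "h \<in> gl scale V"
        using h S by blast
      have "u \<in> {u \<in> V. h u - scale (l h) u \<in> P n}"
      proof (rule subsetD[OF span_minimal])
        show "u \<in> span (y ` {..<Suc n})"
          using that by (simp add: P_def)
        have "h (y i) - scale (l h) (y i) \<in> P n" if "i < Suc n" for i
          using triangular[OF h, of i] P_mono[of i n] that by auto
        then show "y ` {..<Suc n} \<subseteq> {u \<in> V. h u - scale (l h) u \<in> P n}"
          using yV by auto
        have add: "h (a + b) - scale (l h) (a + b) =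
            (h a - scale (l h) a) + (h b - scale (l h) b)" if "a \<in> V" "b \<in> V" for a b
          using that by (simp add: gl_add[OF h_gl] scale_right_distrib)
        have scl: "h (scale c a) - scale (l h) (scale c a) = scale c (h a - scale (l h) a)"
          if "a \<in> V" for a c
          using that
          by (simp add: gl_scale[OF h_gl] scale_right_diff_distrib mult.commute)
        show "subspace {u \<in> V. h u - scale (l h) u \<in> P n}"
          unfolding subspace_def
          using subspace_V P_sub[of n]
          by (auto simp: add scl gl_zero[OF h_gl] simp del: scale_scale
              intro: subspace_0 subspace_add subspace_scale)
      qed
      then show ?thesis by simp
    qed
    have "(h (y (Suc n)) - scale (l h) (y (Suc n)))
        - (h (y (Suc n)) - scale (l h) (y (Suc n)) - scale (of_nat (Suc n) * \<mu>) (y n)) \<in> P n"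
      by (rule subspace_diff[OF P_sub hD[OF that(1)] superdiagonal])
    then have "scale (of_nat (Suc n) * \<mu>) (y n) \<in> P n"
      by (simp del: of_nat_Suc)
    then have "scale (inverse (of_nat (Suc n) * \<mu>)) (scale (of_nat (Suc n) * \<mu>) (y n)) \<in> P n"
      by (rule subspace_scale[OF P_sub])
    moreover have "inverse (of_nat (Suc n) * \<mu>) * (of_nat (Suc n) * \<mu>) = 1"
      using that(2) by (intro left_inverse) (simp del: of_nat_Suc)
    ultimately show ?thesis
      by (simp only: scale_scale scale_one)
  qed
  obtain N where N: "y N \<in> P N"
    using sequence_dependent[of y] yV unfolding P_def by blast
  have "\<mu> = 0"
  proof (rule ccontr)
    assume "\<mu> \<noteq> 0"
    from N show False
    proof (induction N)
      case 0
      then show ?case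
        using v by (simp add: P_def y_def)
    next
      case (Suc N)
      then show ?case
        using descend \<open>\<mu> \<noteq> 0\<close> by blast
    qed
  qed
  then show ?thesis
    using l[OF ideal[OF h]] by (simp add: \<mu>_def)
qed


end

section \<open>Derived series\<close>

context lie_algebra
begin

lemma bracket_skew: "x \<in> L \<Longrightarrow> y \<in> L \<Longrightarrow> bracket y x = - bracket x y"
  using bracket_self[of "x + y"] bracket_self[of x] bracket_self[of y]
    subspace_add[OF subspace_carrier]
  by (simp add: bracket_add_left bracket_add_right eq_neg_iff_add_eq_0 add.commute)

lemma bracket_minus_left: "x \<in> L \<Longrightarrow> y \<in> L \<Longrightarrow> bracket (- x) y = - bracket x y"
  using bracket_scale_left[of x y "- 1"] by simp

lemma bracket_zero_left: "x \<in> L \<Longrightarrow> bracket 0 x = 0"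
  using bracket_scale_left[of x x 0] by simp

lemma bracket_derivation:
  assumes "a \<in> L" "b \<in> L" "x \<in> L"
  shows "bracket (bracket a b) x = bracket (bracket a x) b + bracket a (bracket b x)"
proof -
  have "bracket x (bracket a b) = - bracket (bracket a b) x"
    using assms by (intro bracket_skew bracket_closed)
  moreover have "bracket b (bracket x a) = - bracket (bracket x a) b"
    using assms by (intro bracket_skew bracket_closed)
  moreover have "bracket (bracket x a) b = - bracket (bracket a x) b"
    using assms by (simp add: bracket_skew[of a x] bracket_minus_left bracket_closed)
  ultimately show ?thesis
    using jacobi[OF assms] by (simp add: algebra_simps)
qed

lemma subspace_derived_series: "subspace (derived_series scale bracket L k)"
  using subspace_carrier by (cases k) (simp_all add: bracket_span_def)

lemma derived_series_subset: "derived_series scale bracket L k \<subseteq> L"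
proof (induction k)
  case (Suc k)
  then show ?case
    unfolding derived_series.simps bracket_span_def
    by (intro span_minimal subspace_carrier) (auto intro: bracket_closed)
qed simp

lemma bracket_mem_derived_series_Suc:
  assumes "a \<in> derived_series scale bracket L k" "b \<in> derived_series scale bracket L k"
  shows "bracket a b \<in> derived_series scale bracket L (Suc k)"
  using assms unfolding derived_series.simps bracket_span_def by (intro span_base) blast

text \<open>
  An ideal of \<open>L\<close> has an ideal as its bracket square, since \<open>[\<cdot>, x]\<close> is a derivation.
\<close>

lemma derived_series_ideal:
  assumes "a \<in> derived_series scale bracket L k" "x \<in> L"
  shows "bracket a x \<in> derived_series scale bracket L k"
  using assms
proof (induction k arbitrary: a)
  case 0
  then show ?case by (simp add: bracket_closed)
next
  case (Suc k)
  let ?D = "derived_series scale bracket L"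
  let ?T = "{a \<in> L. bracket a x \<in> ?D (Suc k)}"
  have T: "subspace ?T"
    unfolding subspace_def
    using Suc.prems(2) subspace_0[OF subspace_carrier] subspace_add[OF subspace_carrier]
      subspace_scale[OF subspace_carrier] subspace_0[OF subspace_derived_series]
      subspace_add[OF subspace_derived_series] subspace_scale[OF subspace_derived_series]
    by (simp add: bracket_zero_left bracket_add_left bracket_scale_left
        del: derived_series.simps)
  have "bracket a b \<in> ?T" if "a \<in> ?D k" "b \<in> ?D k" for a b
  proof -
    have ab: "a \<in> L" "b \<in> L"
      using that derived_series_subset by blast+
    show ?thesis
      using bracket_derivation[OF ab Suc.prems(2)] Suc.IH[OF that(1) Suc.prems(2)]
        Suc.IH[OF that(2) Suc.prems(2)] that bracket_closed[OF ab]
      by (simp add: bracket_mem_derived_series_Suc subspace_add[OF subspace_derived_series]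
          del: derived_series.simps)
  qed
  then have "?D (Suc k) \<subseteq> ?T"
    unfolding derived_series.simps(2)[of _ _ _ k] bracket_span_def
    by (intro span_minimal) (use T[unfolded derived_series.simps bracket_span_def] in auto)
  with Suc.prems(1) show ?case
    by auto
qed

end

section \<open>Irreducible solvable Lie algebras of endomorphisms\<close>

context finite_dim_endomorphisms
begin

text \<open>
  Over a field of characteristic zero a scalar commutator \<open>[a, b] = c\<close> vanishes.  An eigenvector
  of \<open>a\<close> is a common eigenvector of \<open>a\<close>, \<open>[a, b]\<close> and \<open>0 = [[a, b], b]\<close>, so
  \<open>[a, b]\<close> kills it and \<open>c = 0\<close>.
\<close>

lemma commute_if_commutator_scalar:
  assumes a: "a \<in> gl scale V" and b: "b \<in> gl scale V" and V: "V \<noteq> {0}"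
    and c: "\<And>v. v \<in> V \<Longrightarrow> commutator a b v = scale c v" and v: "v \<in> V"
  shows "a (b v) = b (a v)"
proof -
  interpret gl: lie_algebra "end_scale scale" commutator "gl scale V"
    by (rule lie_algebra_gl[OF vector_space_axioms subspace_V])
  let ?z = "commutator a b"
  obtain u d where u: "u \<in> V" "u \<noteq> 0" "a u = scale d u"
    using eigenvector_exists[OF a subspace_V order_refl V] gl_mem[OF a] by blast
  have z: "?z \<in> gl scale V"
    by (rule gl.bracket_closed[OF a b])
  have "commutator ?z b w = 0" for w
    using c gl_mem[OF b] gl_scale[OF b] gl_outside[OF z] gl_outside[OF b] gl_zero[OF b]
      gl_zero[OF z] by (cases "w \<in> V") (simp_all add: commutator_def[of ?z])
  then have zb: "commutator ?z b = 0"
    by (simp add: fun_eq_iff)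
  have zero_comm: "commutator 0 b = 0"
    using gl_zero[OF b] by (simp add: commutator_def fun_eq_iff)
  have zero_gl: "0 \<in> gl scale V"
    by (rule gl.subspace_0[OF gl.subspace_carrier])
  have "?z u = 0"
  proof (rule commutator_kills_common_eigenvector[of "{a, ?z, 0}"])
    show "\<exists>e. h u = scale e u" if "h \<in> {a, ?z, 0}" for h
      using that u(3) c[OF u(1)] by (auto intro: exI[of _ 0])
  qed (use a b u z zb zero_comm zero_gl in auto)
  with c[OF u(1)] u(2) have "c = 0"
    by simp
  with c[OF v] show ?thesis
    by (simp add: commutator_def)
qed

lemma irreducible_solvable_acts_by_scalars:
  assumes G: "G \<subseteq> gl scale V" and solv: "lie_solvable (end_scale scale) commutator G"
    and V: "V \<noteq> {0}"
    and irr: "\<And>W. subspace W \<Longrightarrow> W \<subseteq> V \<Longrightarrow> (\<And>x w. x \<in> G \<Longrightarrow> w \<in> W \<Longrightarrow> x w \<in> W) \<Longrightarrow> W = {0} \<or> W = V"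
  shows "\<forall>a\<in>G. \<exists>c. \<forall>v\<in>V. a v = scale c v"
proof -
  interpret G: lie_algebra "end_scale scale" commutator G
    using solv by (simp add: lie_solvable_def)
  let ?D = "derived_series (end_scale scale) commutator G"
  obtain m where m: "?D m = {0}"
    using solv by (auto simp: lie_solvable_def)
  have D_gl: "?D k \<subseteq> gl scale V" for k
    using G.derived_series_subset G by blast
  have descend: "\<forall>a\<in>?D k. \<exists>c. \<forall>v\<in>V. a v = scale c v"
    if IH: "\<forall>a\<in>?D (Suc k). \<exists>c. \<forall>v\<in>V. a v = scale c v" for k
  proof -
    have comm: "a (b v) = b (a v)" if ab: "a \<in> ?D k" "b \<in> ?D k" and v: "v \<in> V" for a b v
    proof -
      obtain c where "\<And>v. v \<in> V \<Longrightarrow> commutator a b v = scale c v"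
        using IH G.bracket_mem_derived_series_Suc[OF ab] by blast
      then show ?thesis
        using commute_if_commutator_scalar[OF _ _ V _ v] D_gl ab by blast
    qed
    have "\<exists>v\<in>V. v \<noteq> 0 \<and> (\<forall>a\<in>?D k. \<exists>c. a v = scale c v)"
      by (rule common_eigenvector_of_commuting[OF D_gl V]) (rule comm)
    then obtain v where v: "v \<in> V" "v \<noteq> 0" and "\<forall>a\<in>?D k. \<exists>c. a v = scale c v"
      by blast
    then obtain l where l: "\<And>a. a \<in> ?D k \<Longrightarrow> a v = scale (l a) v"
      by metis
    \<comment> \<open>The weight space of \<open>l\<close>: its \<open>G\<close>-invariance is the vanishing of \<open>l [a, x]\<close>.\<close>
    let ?W = "{w \<in> V. \<forall>a\<in>?D k. a w = scale (l a) w}"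
    have "?W = {0} \<or> ?W = V"
    proof (rule irr)
      have "a 0 = 0" "\<And>u w. u \<in> V \<Longrightarrow> w \<in> V \<Longrightarrow> a (u + w) = a u + a w"
        "\<And>c w. w \<in> V \<Longrightarrow> a (scale c w) = scale c (a w)" if "a \<in> ?D k" for a
        using that D_gl gl_zero gl_add gl_scale by blast+
      then show "subspace ?W"
        using subspace_0[OF subspace_V] subspace_add[OF subspace_V] subspace_scale[OF subspace_V]
        by (simp add: subspace_def scale_right_distrib scale_left_commute del: scale_scale)
      fix x w assume x: "x \<in> G" and w: "w \<in> ?W"
      have x_gl: "x \<in> gl scale V" and wV: "w \<in> V"
        using x G w by auto
      have "a (x w) = scale (l a) (x w)" if a: "a \<in> ?D k" for a
      proof (cases "w = 0")
        case True
        have "a \<in> gl scale V"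
          using a D_gl by blast
        with True show ?thesis
          using gl_zero[of a] gl_zero[OF x_gl] by simp
      next
        case False
        have "commutator a x w = 0"
          by (rule commutator_kills_common_eigenvector[OF D_gl x_gl _ wV False _ a])
            (use w G.derived_series_ideal[OF _ x] in auto)
        moreover have "a w = scale (l a) w"
          using w a by simp
        ultimately show ?thesis
          by (simp add: commutator_def gl_scale[OF x_gl wV])
      qed
      then show "x w \<in> ?W"
        using gl_mem[OF x_gl wV] by simp
    qed auto
    moreover have "v \<in> ?W"
      using v l by simp
    ultimately have "?W = V"
      using v(2) by blast
    then show ?thesis
      by blast
  qed
  have "\<forall>a\<in>?D m. \<exists>c. \<forall>v\<in>V. a v = scale c v"
    unfolding m by (auto intro: exI[of _ 0])
  then have "\<forall>a\<in>?D 0. \<exists>c. \<forall>v\<in>V. a v = scale c v"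
  proof (induction m)
    case (Suc m)
    from Suc.IH[OF descend[OF Suc.prems]] show ?case .
  qed
  then show ?thesis
    by simp
qed

text \<open>
  When all operators are scalars every line is invariant, and an irreducible space has no room for
  a second one.
\<close>

lemma irreducible_solvable_is_line:
  assumes G: "G \<subseteq> gl scale V" and solv: "lie_solvable (end_scale scale) commutator G"
    and V: "V \<noteq> {0}"
    and irr: "\<And>W. subspace W \<Longrightarrow> W \<subseteq> V \<Longrightarrow> (\<And>x w. x \<in> G \<Longrightarrow> w \<in> W \<Longrightarrow> x w \<in> W) \<Longrightarrow> W = {0} \<or> W = V"
  shows "\<exists>v. v \<noteq> 0 \<and> V = span {v}"
proof -
  have scalars: "\<forall>x\<in>G. \<exists>c. \<forall>w\<in>V. x w = scale c w"
    using assms by (rule irreducible_solvable_acts_by_scalars)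
  obtain v where v: "v \<in> V" "v \<noteq> 0"
    using V subspace_0[OF subspace_V] by blast
  have "span {v} \<subseteq> V"
    using v(1) by (intro span_minimal subspace_V) simp
  moreover have "x w \<in> span {v}" if "x \<in> G" "w \<in> span {v}" for x w
  proof -
    have "w \<in> V"
      using that(2) \<open>span {v} \<subseteq> V\<close> by blast
    moreover from bspec[OF scalars that(1)] obtain c where "\<forall>w\<in>V. x w = scale c w"
      by (elim exE)
    ultimately have "x w = scale c w"
      by simp
    with that show ?thesis
      by (simp add: span_scale)
  qed
  ultimately have "span {v} = {0} \<or> span {v} = V"
    by (intro irr) auto
  then show ?thesis
    using v span_base[of v "{v}"] by auto
qed

end

lemma irr_solvable_rep_space_is_line:
  fixes s :: "'k::{alg_closed_field, field_char_0} \<Rightarrow> 'v::ab_group_add \<Rightarrow> 'v"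
  assumes "(V, \<phi>) \<in> (ym_irr_solvable_reps s :: ('k, 'n::finite, 'v) ym_rep set)"
  shows "\<exists>v. v \<noteq> 0 \<and> V = module.span s {v}"
proof -
  note rep = assms[unfolded ym_irr_solvable_reps_def mem_Collect_eq lie_representation_def
      finite_dim_rep_def solvable_rep_def irreducible_rep_def prod.case]
  interpret vector_space s
    using rep by blast
  interpret finite_dim_endomorphisms s V
    by unfold_locales (use rep in blast)
  show ?thesis
  proof (rule irreducible_solvable_is_line)
    show "range \<phi> \<subseteq> gl s V"
      using rep by (simp add: lie_hom_def linear_map_on_def)
    show "lie_solvable (end_scale s) commutator (range \<phi>)" "V \<noteq> {0}"
      using rep by blast+
    show "W = {0} \<or> W = V"
      if "subspace W" "W \<subseteq> V" "\<And>x w. x \<in> range \<phi> \<Longrightarrow> w \<in> W \<Longrightarrow> x w \<in> W" for W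
      using rep that by blast
  qed
qed

section \<open>Characters of the Yang--Mills algebra\<close>

lemma ym_class_add: "ym_class (x + y) = ym_class x + ym_class y"
  by (rule plus_ym_ab.abs_eq[symmetric])

lemma ym_class_scale: "ym_class (ym_scale c x) = ym_ab_scale c (ym_class x)"
  by (rule ym_ab_scale.abs_eq[symmetric])

lemma ym_bracket_mem_C1: "ym_bracket x y \<in> ym_C 1"
proof -
  interpret Y: lie_algebra ym_scale ym_bracket UNIV by (rule lie_algebra_ym)
  show ?thesis
    unfolding One_nat_def lower_central_series.simps bracket_span_def
    by (rule Y.span_base) auto
qed

lemma ym_class_bracket: "ym_class (ym_bracket x y) = 0"
  unfolding zero_ym_ab.abs_eq ym_ab.abs_eq_iff using ym_bracket_mem_C1 by simp

lemma vector_space_field: "vector_space ((*) :: 'k::field \<Rightarrow> 'k \<Rightarrow> 'k)"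
  by unfold_locales (simp_all add: algebra_simps)

text \<open>
  Every element of the abelianization is a class, so linearity can be tested on classes.
\<close>

lemma ym_ab_dual_iff:
  "f \<in> ym_ab_dual \<longleftrightarrow>
    (\<forall>x y. f (ym_class (x + y)) = f (ym_class x) + f (ym_class y)) \<and>
    (\<forall>c x. f (ym_class (ym_scale c x)) = c * f (ym_class x))"
proof -
  have all_classes: "(\<forall>a. P a) \<longleftrightarrow> (\<forall>x. P (ym_class x))" for P :: "('a, 'b) ym_ab \<Rightarrow> bool"
    by (metis ym_ab.abs_induct)
  show ?thesis
    by (simp add: ym_ab_dual_def Vector_Spaces.linear_iff vector_space_ym_ab vector_space_field
        all_classes ym_class_add ym_class_scale)
qed

lemma factor_through_abelianization:
  fixes g :: "('k::field, 'n::finite) ym \<Rightarrow> 'k"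
  assumes add: "\<And>x y. g (x + y) = g x + g y" and scl: "\<And>c x. g (ym_scale c x) = c * g x"
    and br: "\<And>x y. g (ym_bracket x y) = 0"
  shows "\<exists>f\<in>ym_ab_dual. \<forall>x. f (ym_class x) = g x"
proof -
  interpret Y: lie_algebra ym_scale ym_bracket "UNIV :: ('k, 'n) ym set" by (rule lie_algebra_ym)
  have "g 0 = 0"
    using scl[of 0 0] by simp
  then have "Y.subspace {x. g x = 0}"
    by (simp add: Y.subspace_def add scl)
  then have C1: "ym_C 1 \<subseteq> {x. g x = 0}"
    unfolding One_nat_def lower_central_series.simps bracket_span_def
    by (intro Y.span_minimal) (auto simp: br)
  define f where "f a = g (rep_ym_ab a)" for a
  have f: "f (ym_class x) = g x" for x
  proof -
    have "ym_class (rep_ym_ab (ym_class x)) = ym_class x"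
      by (rule Quotient3_abs_rep[OF Quotient3_ym_ab])
    then have "rep_ym_ab (ym_class x) - x \<in> ym_C 1"
      by (simp add: ym_ab.abs_eq_iff)
    then have "g (rep_ym_ab (ym_class x) - x) = 0"
      using C1 by auto
    then show ?thesis
      using add[of "rep_ym_ab (ym_class x) - x" x] by (simp add: f_def)
  qed
  moreover have "f \<in> ym_ab_dual"
    by (simp add: ym_ab_dual_iff f add scl)
  ultimately show ?thesis by blast
qed

text \<open>
  The ambient space is a parameter because \<open>ym_char_class\<close> compares representations in the
  ambient space of \<open>s\<close> with representations on the field itself.
\<close>

definition has_character ::
  "('k::field \<Rightarrow> 'v::ab_group_add \<Rightarrow> 'v) \<Rightarrow> ('k, 'n::finite, 'v) ym_rep \<Rightarrow> (('k, 'n) ym_ab \<Rightarrow> 'k) \<Rightarrow> bool"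
  where "has_character s R f \<longleftrightarrow>
    (\<exists>v. v \<noteq> 0 \<and> fst R = module.span s {v}) \<and>
    (\<forall>x. \<forall>w\<in>fst R. snd R x w = s (f (ym_class x)) w)"

lemma irr_solvable_rep_has_character:
  fixes s :: "'k::{alg_closed_field, field_char_0} \<Rightarrow> 'v::ab_group_add \<Rightarrow> 'v"
  assumes "R \<in> (ym_irr_solvable_reps s :: ('k, 'n::finite, 'v) ym_rep set)"
  shows "\<exists>f\<in>ym_ab_dual. has_character s R f"
proof -
  obtain V \<phi> where R: "R = (V, \<phi>)"
    by (cases R)
  note rep = assms[unfolded R]
  interpret vector_space s
    using rep by (simp add: ym_irr_solvable_reps_def lie_representation_def)
  obtain v where v: "v \<noteq> 0" "V = span {v}"
    using irr_solvable_rep_space_is_line[OF rep] by blast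
  have hom: "lie_hom ym_scale ym_bracket UNIV (end_scale s) commutator (gl s V) \<phi>"
    using rep by (simp add: ym_irr_solvable_reps_def lie_representation_def)
  have add: "\<phi> (x + y) w = \<phi> x w + \<phi> y w" and scl: "\<phi> (ym_scale c x) w = s c (\<phi> x w)"
    and br: "\<phi> (ym_bracket x y) w = \<phi> x (\<phi> y w) - \<phi> y (\<phi> x w)" for x y c w
    using hom by (simp_all add: lie_hom_def linear_map_on_def end_scale_def commutator_def)
  have gl: "\<phi> x \<in> gl s V" for x
    using hom by (auto simp: lie_hom_def linear_map_on_def)
  have V: "v \<in> V"
    unfolding v(2) by (rule span_base) simp
  have "\<phi> x v \<in> span {v}" for x
    using gl[of x] V by (auto simp: gl_def linear_map_on_def v(2))
  then have "\<exists>c. \<phi> x v = s c v" for x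
    by (auto simp: span_singleton)
  then obtain g where g: "\<And>x. \<phi> x v = s (g x) v"
    by metis
  have act: "\<phi> x (s c v) = s (g x) (s c v)" for x c
  proof -
    have "\<phi> x (s c v) = s c (\<phi> x v)"
      using gl[of x] V by (simp add: gl_def linear_map_on_def)
    then show ?thesis
      by (simp add: g mult.commute)
  qed
  have inj: "s a v = s b v \<Longrightarrow> a = b" for a b
    using v(1) by simp
  \<comment> \<open>Brackets act by \<open>g x * g y - g y * g x\<close>, which is zero in the field.\<close>
  have "\<exists>f\<in>ym_ab_dual. \<forall>x. f (ym_class x) = g x"
  proof (rule factor_through_abelianization)
    show "g (x + y) = g x + g y" for x y
      by (rule inj) (simp add: scale_left_distrib add flip: g)
    show "g (ym_scale c x) = c * g x" for c x
    proof (rule inj)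
      show "s (g (ym_scale c x)) v = s (c * g x) v"
        using scl[of c x v] by (simp add: g)
    qed
    show "g (ym_bracket x y) = 0" for x y
    proof (rule inj)
      show "s (g (ym_bracket x y)) v = s 0 v"
        using br[of x y v] by (simp add: g act mult.commute)
    qed
  qed
  then obtain f where f: "f \<in> ym_ab_dual" "\<And>x. f (ym_class x) = g x"
    by blast
  have "\<phi> x w = s (f (ym_class x)) w" if "w \<in> V" for x w
    using that act unfolding v(2) span_singleton f(2) by blast
  with f(1) v show ?thesis
    unfolding has_character_def R by auto
qed

text \<open>
  An intertwining map sends a generator of one line to a generator of the other, on which the
  scalar actions can be compared.  Conversely any linear bijection of the lines intertwines equal
  scalar actions.
\<close>

lemma rep_iso_iff_same_character:
  fixes R :: "('k::field, 'n::finite, 'v::ab_group_add) ym_rep"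
    and R' :: "('k, 'n, 'w::ab_group_add) ym_rep"
  assumes vs: "vector_space s" "vector_space s'"
    and f: "has_character s R f" and f': "has_character s' R' f'"
  shows "rep_iso s s' R R' \<longleftrightarrow> f = f'"
proof -
  interpret A: vector_space s by fact
  interpret B: vector_space s' by fact
  obtain V \<phi> W \<psi> where R: "R = (V, \<phi>)" "R' = (W, \<psi>)"
    by (cases R, cases R')
  obtain v where v: "v \<noteq> 0" "V = A.span {v}"
    using f by (auto simp: has_character_def R)
  obtain w where w: "w \<noteq> 0" "W = B.span {w}"
    using f' by (auto simp: has_character_def R)
  have \<phi>: "\<phi> x u = s (f (ym_class x)) u" if "u \<in> V" for x u
    using f that by (simp add: has_character_def R)
  have \<psi>: "\<psi> x u = s' (f' (ym_class x)) u" if "u \<in> W" for x u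
    using f' that by (simp add: has_character_def R)
  have vV: "s c v \<in> V" for c
    by (auto simp: v(2) A.span_singleton)
  have wW: "s' c w \<in> W" for c
    by (auto simp: w(2) B.span_singleton)
  have V_cases: "\<exists>c. u = s c v" if "u \<in> V" for u
    using that by (auto simp: v(2) A.span_singleton)
  show ?thesis
  proof
    assume "rep_iso s s' R R'"
    then obtain T where T: "linear_map_on s V s' W T" "bij_betw T V W"
      and equiv: "\<And>x u. u \<in> V \<Longrightarrow> T (\<phi> x u) = \<psi> x (T u)"
      by (auto simp: rep_iso_def R)
    have v1: "v \<in> V" and v0: "0 \<in> V"
      using vV[of 1] vV[of 0] by simp_all
    have T_scale: "T (s c v) = s' c (T v)" for c
      using T(1) v1 by (simp add: linear_map_on_def)
    have "T 0 = 0"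
      using T_scale[of 0] by simp
    then have "T v \<noteq> 0"
      using inj_onD[OF bij_betw_imp_inj_on[OF T(2)] _ v1 v0] v(1) by auto
    moreover have "T v \<in> W"
      using T(1) v1 by (auto simp: linear_map_on_def)
    then have "s' (f (ym_class x)) (T v) = s' (f' (ym_class x)) (T v)" for x
      using equiv[OF v1, of x] by (simp add: \<phi>[OF v1] \<psi> T_scale)
    ultimately have "f (ym_class x) = f' (ym_class x)" for x
      by simp
    then show "f = f'"
      by (intro ext) (rule ym_ab.abs_induct)
  next
    assume "f = f'"
    define T where "T u = s' (THE c. u = s c v) w" for u
    have T: "T (s c v) = s' c w" for c
      using v(1) by (simp add: T_def)
    have "linear_map_on s V s' W T"
      unfolding linear_map_on_def
    proof (intro conjI ballI allI)
      show "T ` V \<subseteq> W"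
        using V_cases T wW by fastforce
      show "T (a + b) = T a + T b" if ab: "a \<in> V" "b \<in> V" for a b
      proof -
        obtain c d where "a = s c v" "b = s d v"
          using V_cases[OF ab(1)] V_cases[OF ab(2)] by blast
        then show ?thesis
          by (simp add: T B.scale_left_distrib flip: A.scale_left_distrib)
      qed
      show "T (s c a) = s' c (T a)" if a: "a \<in> V" for c a
      proof -
        obtain d where "a = s d v"
          using V_cases[OF a] by blast
        then show ?thesis
          using T[of "c * d"] T[of d] by simp
      qed
    qed
    moreover have "bij_betw T V W"
    proof (rule bij_betw_imageI)
      show "inj_on T V"
      proof (rule inj_onI)
        fix a b assume ab: "a \<in> V" "b \<in> V" and eq: "T a = T b"
        obtain c d where "a = s c v" "b = s d v"
          using V_cases[OF ab(1)] V_cases[OF ab(2)] by blast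
        with eq w(1) show "a = b"
          by (simp add: T)
      qed
      have "V = range (\<lambda>c. s c v)" "W = range (\<lambda>c. s' c w)"
        by (simp_all add: v(2) w(2) A.span_singleton B.span_singleton)
      then show "T ` V = W"
        by (simp add: image_image T)
    qed
    moreover have "T (\<phi> x u) = \<psi> x (T u)" if "u \<in> V" for x u
    proof -
      have "T (\<phi> x u) = s' (f (ym_class x)) (T u)"
        using calculation(1) that by (simp add: \<phi> linear_map_on_def)
      moreover have "T u \<in> W"
        using \<open>linear_map_on s V s' W T\<close> that by (auto simp: linear_map_on_def)
      ultimately show ?thesis
        using \<open>f = f'\<close> by (simp add: \<psi>)
    qed
    ultimately show "rep_iso s s' R R'"
      by (auto simp: rep_iso_def R)
  qed
qed

section \<open>The line carrying a given character\<close>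

lemma (in lie_algebra) lie_subalgebra:
  assumes "subspace M" "M \<subseteq> L" "\<And>x y. x \<in> M \<Longrightarrow> y \<in> M \<Longrightarrow> bracket x y \<in> M"
  shows "lie_algebra scale bracket M"
proof -
  have "x \<in> M \<Longrightarrow> x \<in> L" for x
    using assms(2) by blast
  then show ?thesis
    by unfold_locales
      (simp_all add: assms(1,3) bracket_add_left bracket_add_right bracket_scale_left
        bracket_scale_right bracket_self jacobi)
qed

text \<open>
  The value zero outside the line is the encoding of endomorphisms of a subspace used in \<open>gl\<close>.
\<close>

definition line_rep ::
  "('k::field \<Rightarrow> 'v::ab_group_add \<Rightarrow> 'v) \<Rightarrow> 'v \<Rightarrow> (('k, 'n::finite) ym_ab \<Rightarrow> 'k) \<Rightarrow> ('k, 'n, 'v) ym_rep"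
  where "line_rep s v f =
    (module.span s {v}, \<lambda>x w. if w \<in> module.span s {v} then s (f (ym_class x)) w else 0)"

lemma line_rep_has_character: "v \<noteq> 0 \<Longrightarrow> has_character s (line_rep s v f) f"
  by (auto simp: has_character_def line_rep_def)

text \<open>
  The image is abelian, since it consists of scalars on a line; its derived series vanishes after
  one step.
\<close>

lemma line_rep_irr_solvable:
  fixes s :: "'k::field \<Rightarrow> 'v::ab_group_add \<Rightarrow> 'v"
    and f :: "('k, 'n::finite) ym_ab \<Rightarrow> 'k"
  assumes "vector_space s" and v: "v \<noteq> 0" and f: "f \<in> ym_ab_dual"
  shows "line_rep s v f \<in> ym_irr_solvable_reps s"
proof -
  interpret vector_space s by fact
  interpret Y: lie_algebra ym_scale ym_bracket "UNIV :: ('k, 'n) ym set" by (rule lie_algebra_ym)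
  let ?V = "span {v}"
  define \<phi> where "\<phi> x w = (if w \<in> ?V then s (f (ym_class x)) w else 0)" for x w
  interpret gl: lie_algebra "end_scale s" commutator "gl s ?V"
    by (rule lie_algebra_gl[OF vector_space_axioms subspace_span])
  have f_add: "f (ym_class (x + y)) = f (ym_class x) + f (ym_class y)"
    and f_scale: "f (ym_class (ym_scale c x)) = c * f (ym_class x)" for x y c
    using f unfolding ym_ab_dual_iff by blast+
  have "f 0 = 0"
    using f_scale[of 0 0] by (simp add: zero_ym_ab.abs_eq)
  then have f_bracket: "f (ym_class (ym_bracket x y)) = 0" for x y
    by (simp add: ym_class_bracket)
  have gl: "\<phi> x \<in> gl s ?V" for x
    by (auto simp: gl_def linear_map_on_def \<phi>_def span_add span_scale scale_right_distrib
        mult.commute)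
  have add: "\<phi> (x + y) = \<phi> x + \<phi> y" for x y
    by (simp add: fun_eq_iff \<phi>_def f_add scale_left_distrib)
  have scl: "\<phi> (ym_scale c x) = end_scale s c (\<phi> x)" for c x
    by (simp add: fun_eq_iff \<phi>_def f_scale end_scale_def)
  have comm: "commutator (\<phi> x) (\<phi> y) = 0" for x y
    by (simp add: fun_eq_iff \<phi>_def commutator_def span_scale mult.commute)
  have bracket: "\<phi> (ym_bracket x y) = commutator (\<phi> x) (\<phi> y)" for x y
    unfolding comm by (simp add: fun_eq_iff \<phi>_def f_bracket)
  have hom: "lie_hom ym_scale ym_bracket UNIV (end_scale s) commutator (gl s ?V) \<phi>"
    using gl by (auto simp: lie_hom_def linear_map_on_def add scl bracket)
  have zero: "0 \<in> range \<phi>"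
    using comm[of 0 0] bracket[of 0 0] by (metis rangeI)
  have "gl.subspace (range \<phi>)"
    using zero by (auto simp: gl.subspace_def simp flip: add scl)
  then have "lie_algebra (end_scale s) commutator (range \<phi>)"
    by (rule gl.lie_subalgebra) (use gl comm zero in auto)
  moreover have "derived_series (end_scale s) commutator (range \<phi>) 1 = {0}"
  proof -
    have "{commutator a b |a b. a \<in> range \<phi> \<and> b \<in> range \<phi>} \<subseteq> {0}"
      using comm by auto
    then have "gl.span {commutator a b |a b. a \<in> range \<phi> \<and> b \<in> range \<phi>} \<subseteq> {0}"
      by (rule gl.span_minimal[OF _ gl.subspace_single_0])
    then show ?thesis
      using gl.span_zero by (auto simp: bracket_span_def)
  qed
  ultimately have solv: "lie_solvable (end_scale s) commutator (range \<phi>)"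
    unfolding lie_solvable_def by blast
  have "?V \<noteq> {0}"
    using v span_base[of v "{v}"] by auto
  moreover have "W = {0} \<or> W = ?V" if W: "subspace W" "W \<subseteq> ?V" for W
  proof (rule disjCI)
    assume "W \<noteq> ?V"
    then have "v \<notin> W"
      using W span_minimal[of "{v}" W] by auto
    have "c = 0" if "s c v \<in> W" for c
    proof (rule ccontr)
      assume "c \<noteq> 0"
      with subspace_scale[OF W(1) that, of "inverse c"] \<open>v \<notin> W\<close> show False
        by simp
    qed
    then show "W = {0}"
      using W subspace_0[OF W(1)] by (fastforce simp: span_singleton)
  qed
  ultimately have irr: "irreducible_rep s (?V, \<phi>)"
    unfolding irreducible_rep_def by blast
  have "line_rep s v f = (?V, \<phi>)"
    by (simp add: line_rep_def \<phi>_def fun_eq_iff)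
  with hom solv irr vector_space_axioms show ?thesis
    by (auto simp: ym_irr_solvable_reps_def lie_representation_def finite_dim_rep_def
        solvable_rep_def intro: exI[of _ "{v}"])
qed

lemma ym_char_rep_eq_line_rep: "ym_char_rep f = line_rep (*) 1 f"
proof -
  interpret K: vector_space "(*) :: 'a \<Rightarrow> 'a \<Rightarrow> 'a"
    by (rule vector_space_field)
  have "K.span {1} = UNIV"
    by (simp add: K.span_singleton)
  then show ?thesis
    by (simp add: ym_char_rep_def line_rep_def)
qed

section \<open>The classification\<close>

text \<open>
  Both sides describe the same representations: each irreducible solvable one has some character,
  and \<open>ym_char_rep f\<close> has the character \<open>f\<close>.
\<close>

lemma ym_char_class_eq:
  fixes s :: "'k::{alg_closed_field, field_char_0} \<Rightarrow> 'v::ab_group_add \<Rightarrow> 'v"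
    and f :: "('k, 'n::finite) ym_ab \<Rightarrow> 'k"
  assumes "vector_space s"
  shows "ym_char_class s f = {R \<in> ym_irr_solvable_reps s. has_character s R f}"
proof -
  have char: "has_character (*) (ym_char_rep f) f"
    unfolding ym_char_rep_eq_line_rep by (rule line_rep_has_character) simp
  have "rep_iso s (*) R (ym_char_rep f) \<longleftrightarrow> has_character s R f"
    if "R \<in> ym_irr_solvable_reps s" for R
    using irr_solvable_rep_has_character[OF that]
      rep_iso_iff_same_character[OF assms vector_space_field _ char] by blast
  then show ?thesis
    by (auto simp: ym_char_class_def)
qed

lemma has_character_unique:
  assumes "vector_space s" "has_character s R f" "has_character s R g"
  shows "f = g"
proof -
  have "rep_iso s s R R"
    by (auto simp: rep_iso_def linear_map_on_def intro!: exI[of _ id] split: prod.split)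
  with rep_iso_iff_same_character[OF assms(1,1) assms(2,3)] show ?thesis
    by simp
qed

lemma ym_rep_iso_class_eq:
  fixes s :: "'k::{alg_closed_field, field_char_0} \<Rightarrow> 'v::ab_group_add \<Rightarrow> 'v"
    and R :: "('k, 'n::finite, 'v) ym_rep"
  assumes "vector_space s" "R \<in> ym_irr_solvable_reps s" "has_character s R f"
  shows "ym_rep_iso_rel s `` {R} = ym_char_class s f"
proof -
  have "rep_iso s s R R' \<longleftrightarrow> has_character s R' f" if "R' \<in> ym_irr_solvable_reps s" for R'
    using irr_solvable_rep_has_character[OF that]
      rep_iso_iff_same_character[OF assms(1,1,3)] by blast
  with assms(2) show ?thesis
    unfolding ym_char_class_eq[OF assms(1)] by (auto simp: ym_rep_iso_rel_def)
qed

theorem theorem2p10: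
  fixes s :: "'k::{alg_closed_field, field_char_0} \<Rightarrow> 'v::ab_group_add \<Rightarrow> 'v"
  assumes "CARD('n::finite) \<ge> 2"
    and "vector_space s"
  shows "(\<forall>(V, \<phi>) \<in> (ym_irr_solvable_reps s :: ('k, 'n, 'v) ym_rep set). vector_space.dim s V = 1) \<and>
    (\<forall>f \<in> (ym_ab_dual :: (('k, 'n) ym_ab \<Rightarrow> 'k) set).
       ym_char_rep f \<in> ym_irr_solvable_reps (*)) \<and>
    ((\<exists>v::'v. v \<noteq> 0) \<longrightarrow>
       bij_betw (ym_char_class s)
         (ym_ab_dual :: (('k, 'n) ym_ab \<Rightarrow> 'k) set)
         (ym_irr_solvable_classes s :: ('k, 'n, 'v) ym_rep set set))"
proof (intro conjI impI)
  interpret vector_space s by fact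
  have "dim V = 1" if rep: "(V, \<phi>) \<in> (ym_irr_solvable_reps s :: ('k, 'n, 'v) ym_rep set)" for V \<phi>
  proof -
    obtain v where "v \<noteq> 0" "V = span {v}"
      using irr_solvable_rep_space_is_line[OF rep] by blast
    then show ?thesis
      using dim_span_eq_card_independent[of "{v}"] by simp
  qed
  then show "\<forall>(V, \<phi>) \<in> (ym_irr_solvable_reps s :: ('k, 'n, 'v) ym_rep set). dim V = 1"
    by blast
  show "\<forall>f \<in> (ym_ab_dual :: (('k, 'n) ym_ab \<Rightarrow> 'k) set). ym_char_rep f \<in> ym_irr_solvable_reps (*)"
    unfolding ym_char_rep_eq_line_rep
    by (intro ballI line_rep_irr_solvable[OF vector_space_field]) simp_all
  assume "\<exists>v::'v. v \<noteq> 0"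
  then obtain v :: 'v where v: "v \<noteq> 0" by blast
  let ?D = "ym_ab_dual :: (('k, 'n) ym_ab \<Rightarrow> 'k) set"
  have line_class: "ym_rep_iso_rel s `` {line_rep s v f} = ym_char_class s f"
    and line: "line_rep s v f \<in> ym_char_class s f" if "f \<in> ?D" for f
    using line_rep_irr_solvable[OF assms(2) v that] line_rep_has_character[OF v, of s f]
    by (simp_all add: ym_rep_iso_class_eq[OF assms(2)] ym_char_class_eq[OF assms(2)])
  show "bij_betw (ym_char_class s) ?D (ym_irr_solvable_classes s)"
  proof (rule bij_betw_imageI)
    show "inj_on (ym_char_class s) ?D"
    proof (rule inj_onI)
      fix f g assume "f \<in> ?D" "g \<in> ?D" "ym_char_class s f = (ym_char_class s g :: ('k, 'n, 'v) ym_rep set)"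
      then have "line_rep s v f \<in> ym_char_class s f" "line_rep s v f \<in> ym_char_class s g"
        using line[of f] by simp_all
      then show "f = g"
        unfolding ym_char_class_eq[OF assms(2)]
        using has_character_unique[OF assms(2)] by blast
    qed
    show "ym_char_class s ` ?D = ym_irr_solvable_classes s"
    proof (intro equalityI subsetI)
      fix X assume "X \<in> ym_char_class s ` ?D"
      then obtain f where f: "f \<in> ?D" "X = ym_char_class s f"
        by blast
      show "X \<in> ym_irr_solvable_classes s"
        unfolding ym_irr_solvable_classes_def f(2) line_class[OF f(1), symmetric]
        by (intro quotientI line_rep_irr_solvable assms v f(1))
    next
      fix X :: "('k, 'n, 'v) ym_rep set" assume "X \<in> ym_irr_solvable_classes s"
      then obtain R where R: "R \<in> ym_irr_solvable_reps s" "X = ym_rep_iso_rel s `` {R}"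
        unfolding ym_irr_solvable_classes_def by (elim quotientE)
      obtain f where "f \<in> ?D" "has_character s R f"
        using irr_solvable_rep_has_character[OF R(1)] by blast
      then show "X \<in> ym_char_class s ` ?D"
        using ym_rep_iso_class_eq[OF assms(2) R(1)] R(2) by blast
    qed
  qed
qed

end
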